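(* For $n\in\mathbb N$, and for any $\delta>0$, $$\mathbb E_n[\text{Area enclosed by a single traversal}]=\sum_{m=1}^n m\,\mathbb E_m[\tau_f]=\frac{\pi n^2}{4}+O\bigl(n^{(3/2)+\delta}\bigr),$$ where the first equality is exact for every $n\in\mathbb N$ and the second is asymptotic as $n\to\infty$.
   Context: $\operatorname{sgn}(x)=-1,0,1$ according as $x<0$, $x=0$, $x>0$. The fast embedding $(A(t),B(t))_{t\ge0}$ of the simple harmonic urn is the continuous-time Markov chain on $\mathbb Z^2\setminus\{(0,0)\}$ which from state $(a,b)$ jumps to $(a-\operatorname{sgn}(b),b)$ at rate $|b|$ and to $(a,b+\operatorname{sgn}(a))$ at rate $|a|$. Its jump chain is the simple harmonic urn process. $\mathbb E_n$ denotes expectation given $A(0)=n$, $B(0)=0$, and $\tau_f=\inf\{t\ge0:A(t)=0\}$. "Area enclosed by a single traversal" is the area of the region of the first quadrant bounded by the two coordinate axes and the lattice path followed by $(A(t),B(t))$ from $(n,0)$ at time $0$ until it hits the positive $y$-axis at time $\tau_f$ (successive positions joined by unit segments). *)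

theory Defs
  imports "HOL-Probability.Probability" "HOL-Library.Landau_Symbols"
begin

text \<open>
  Jump times of a path with values in a discrete space. If the path has no jump after
  \<open>jump_time x k\<close>, then \<open>jump_time x (Suc k)\<close> is the unspecified real \<open>Inf {}\<close>; this is a null
  event for the chains below, whose exit rates are all positive.
\<close>
primrec jump_time :: "(real \<Rightarrow> 's) \<Rightarrow> nat \<Rightarrow> real" where
  "jump_time x 0 = 0"
| "jump_time x (Suc k) = Inf {t. jump_time x k < t \<and> x t \<noteq> x (jump_time x k)}"

definition jump_chain :: "(real \<Rightarrow> 's) \<Rightarrow> nat \<Rightarrow> 's" where
  "jump_chain x k = x (jump_time x k)"

definition holding_time :: "(real \<Rightarrow> 's) \<Rightarrow> nat \<Rightarrow> real" where
  "holding_time x k = jump_time x (Suc k) - jump_time x k"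

definition exit_rate :: "'s set \<Rightarrow> ('s \<Rightarrow> 's \<Rightarrow> real) \<Rightarrow> 's \<Rightarrow> real" where
  "exit_rate E q i = (\<Sum>\<^sub>\<infinity>j\<in>E - {i}. q i j)"

definition jump_prob :: "'s set \<Rightarrow> ('s \<Rightarrow> 's \<Rightarrow> real) \<Rightarrow> 's \<Rightarrow> 's \<Rightarrow> real" where
  "jump_prob E q i j = (if i = j then 0 else q i j / exit_rate E q i)"

text \<open>
  A right-continuous process \<open>X\<close> is a continuous-time Markov chain on the countable set \<open>E\<close>, started
  at \<open>x\<close>, with jump rates \<open>q i j\<close> (\<open>i \<noteq> j\<close>), if its jump chain is the discrete-time Markov chain with
  transition probabilities \<open>jump_prob E q\<close> and, given the jump chain \<open>i\<^sub>0, i\<^sub>1, \<dots>\<close>, the holding times are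
  independent and exponential with parameters \<open>exit_rate E q i\<^sub>0, exit_rate E q i\<^sub>1, \<dots>\<close>.
  The last condition states this as the joint law of the first \<open>k + 1\<close> states and holding
  times. It is meant for chains without absorbing states.
\<close>
definition markov_jump_process ::
  "'w measure \<Rightarrow> 's set \<Rightarrow> ('s \<Rightarrow> 's \<Rightarrow> real) \<Rightarrow> 's \<Rightarrow> (real \<Rightarrow> 'w \<Rightarrow> 's) \<Rightarrow> bool" where
  "markov_jump_process M E q x X \<longleftrightarrow>
     prob_space M \<and>
     (\<forall>t\<ge>0. X t \<in> M \<rightarrow>\<^sub>M count_space E) \<and>
     (\<forall>\<omega>\<in>space M. \<forall>t\<ge>0. \<forall>\<^sub>F s in at_right t. X s \<omega> = X t \<omega>) \<and>
     (\<forall>k. (\<lambda>\<omega>. jump_chain (\<lambda>t. X t \<omega>) k) \<in> M \<rightarrow>\<^sub>M count_space E) \<and>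
     (\<forall>k. (\<lambda>\<omega>. holding_time (\<lambda>t. X t \<omega>) k) \<in> borel_measurable M) \<and>
     (\<forall>k i s. (\<forall>j\<le>k. i j \<in> E) \<longrightarrow> (\<forall>j\<le>k. 0 \<le> s j) \<longrightarrow>
        measure M {\<omega> \<in> space M. \<forall>j\<le>k.
            jump_chain (\<lambda>t. X t \<omega>) j = i j \<and> s j < holding_time (\<lambda>t. X t \<omega>) j}
        = (if i 0 = x then 1 else 0)
          * (\<Prod>j<k. jump_prob E q (i j) (i (Suc j)))
          * (\<Prod>j\<le>k. exp (- exit_rate E q (i j) * s j)))"

definition urn_rate :: "int \<times> int \<Rightarrow> int \<times> int \<Rightarrow> real" where
  "urn_rate = (\<lambda>(a, b) z.
     (if z = (a - sgn b, b) then real_of_int \<bar>b\<bar> else 0) +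
     (if z = (a, b + sgn a) then real_of_int \<bar>a\<bar> else 0))"

definition fast_embedding ::
  "'w measure \<Rightarrow> int \<times> int \<Rightarrow> (real \<Rightarrow> 'w \<Rightarrow> int) \<Rightarrow> (real \<Rightarrow> 'w \<Rightarrow> int) \<Rightarrow> bool" where
  "fast_embedding M z A B \<longleftrightarrow>
     markov_jump_process M (- {(0, 0)}) urn_rate z (\<lambda>t \<omega>. (A t \<omega>, B t \<omega>))"

text \<open>The value is \<open>\<infinity>\<close> if the path never hits the vertical axis.\<close>
definition traversal_time :: "(real \<Rightarrow> int \<times> int) \<Rightarrow> ennreal" where
  "traversal_time x = Inf (ennreal ` {t. 0 \<le> t \<and> fst (x t) = 0})"

definition lattice_point :: "int \<times> int \<Rightarrow> real \<times> real" where
  "lattice_point = map_prod real_of_int real_of_int"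

definition traversal_path :: "(real \<Rightarrow> int \<times> int) \<Rightarrow> (real \<times> real) set" where
  "traversal_path x =
     (\<Union>k\<in>{k. ennreal (jump_time x k) < traversal_time x}.
        closed_segment (lattice_point (jump_chain x k)) (lattice_point (jump_chain x (Suc k))))"

definition traversal_region :: "(real \<Rightarrow> int \<times> int) \<Rightarrow> (real \<times> real) set" where
  "traversal_region x =
     {p. 0 < fst p \<and> 0 < snd p} \<inter> inside ({p. fst p = 0 \<or> snd p = 0} \<union> traversal_path x)"

definition traversal_area :: "(real \<Rightarrow> int \<times> int) \<Rightarrow> ennreal" where
  "traversal_area x = emeasure lborel (traversal_region x)"

end

theory Submission imports Defs begin

text \<open>
  Write \<open>L f a b = a (f a (b + 1) - f a b) + b (f (a - 1) b - f a b)\<close> for the generator in the first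
  quadrant. The expected traversal time \<open>F a b\<close> from \<open>(a, b)\<close> satisfies \<open>L F = -1\<close>, and the expected
  remaining area \<open>H a b\<close> satisfies \<open>L H = -a\<^sup>2\<close>, because an upward jump from \<open>(a, b)\<close>, which has
  rate \<open>a\<close>, adds a horizontal strip of area \<open>a\<close>. A telescoping sum shows that
  \<open>\<Sum>m=1..a. m F m b\<close> solves the same equation as \<open>H\<close>, and solutions that vanish at \<open>a = 0\<close> and are
  bounded in \<open>b\<close> for each \<open>a\<close> are unique by a maximum principle. For the asymptotics, \<open>F\<close> is
  compared with the angle \<open>arctan (a/b)\<close>, for which \<open>L\<close> gives \<open>-1 + O(1/(a + b))\<close>. A multiple of
  \<open>a/((a + b)(a + b + 1))\<close> absorbs this error, so that \<open>F n 0 = \<pi>/2 + O(1/n)\<close>.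
\<close>

section \<open>Rewards collected by a jump process before a hitting time\<close>

lemma sup_continuous_sum_ennreal:
  fixes f :: "'i \<Rightarrow> 'a::complete_lattice \<Rightarrow> ennreal"
  assumes "\<And>i. i \<in> I \<Longrightarrow> sup_continuous (f i)"
  shows "sup_continuous (\<lambda>x. \<Sum>i\<in>I. f i x)"
  using assms
  by (induction I rule: infinite_finite_induct)
     (auto intro: sup_continuous_const sup_continuous_add_ennreal)

definition successors :: "'s set \<Rightarrow> ('s \<Rightarrow> 's \<Rightarrow> real) \<Rightarrow> 's \<Rightarrow> 's set" where
  "successors E q i = {j \<in> E - {i}. q i j \<noteq> 0}"

locale finitely_branching_rates =
  fixes E :: "'s set" and q :: "'s \<Rightarrow> 's \<Rightarrow> real"
  assumes rate_nonneg: "0 \<le> q i j"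
    and finite_successors: "i \<in> E \<Longrightarrow> finite (successors E q i)"
    and successors_nonempty: "i \<in> E \<Longrightarrow> successors E q i \<noteq> {}"
begin

lemma exit_rate_eq_sum:
  assumes "i \<in> E"
  shows "exit_rate E q i = (\<Sum>j\<in>successors E q i. q i j)"
proof -
  have "exit_rate E q i = infsum (q i) (successors E q i)"
    unfolding exit_rate_def by (rule infsum_cong_neutral) (auto simp: successors_def)
  then show ?thesis using finite_successors[OF assms] by simp
qed

lemma exit_rate_pos:
  assumes "i \<in> E"
  shows "0 < exit_rate E q i"
proof -
  have "0 < q i j" if "j \<in> successors E q i" for j
    using that rate_nonneg[of i j] by (auto simp: successors_def)
  then show ?thesis
    unfolding exit_rate_eq_sum[OF assms] using finite_successors successors_nonempty assms
    by (intro sum_pos) auto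
qed

lemma jump_prob_successor:
  assumes "j \<in> successors E q i"
  shows "jump_prob E q i j = q i j / exit_rate E q i"
  using assms by (auto simp: jump_prob_def successors_def)

lemma jump_prob_nonneg: "i \<in> E \<Longrightarrow> 0 \<le> jump_prob E q i j"
  using exit_rate_pos[of i] rate_nonneg[of i j] by (simp add: jump_prob_def)

lemma sum_jump_prob:
  assumes "i \<in> E"
  shows "(\<Sum>j\<in>successors E q i. jump_prob E q i j) = 1"
proof -
  have "(\<Sum>j\<in>successors E q i. jump_prob E q i j) = (\<Sum>j\<in>successors E q i. q i j) / exit_rate E q i"
    by (simp add: jump_prob_successor sum_divide_distrib)
  then show ?thesis using exit_rate_pos[OF assms] by (simp add: exit_rate_eq_sum[OF assms])
qed

definition mean_next :: "('s \<Rightarrow> ennreal) \<Rightarrow> 's \<Rightarrow> ennreal" where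
  "mean_next u i = (\<Sum>j\<in>successors E q i. ennreal (jump_prob E q i j) * u j)"

definition reward_op :: "'s set \<Rightarrow> ('s \<Rightarrow> ennreal) \<Rightarrow> ('s \<Rightarrow> ennreal) \<Rightarrow> 's \<Rightarrow> ennreal" where
  "reward_op T r u i = (if i \<in> T then 0 else r i + mean_next u i)"

text \<open>
  As a least fixed point, the value is the minimal nonnegative solution of the Poisson equation
  with zero boundary values on \<open>T\<close>.
\<close>
definition hitting_value :: "'s set \<Rightarrow> ('s \<Rightarrow> ennreal) \<Rightarrow> 's \<Rightarrow> ennreal" where
  "hitting_value T r = lfp (reward_op T r)"

lemma sup_continuous_reward_op: "sup_continuous (reward_op T r)"
proof (rule sup_continuous_fun)
  fix i
  show "sup_continuous (\<lambda>u. reward_op T r u i)"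
    unfolding reward_op_def mean_next_def
    by (intro sup_continuous_If sup_continuous_add_ennreal sup_continuous_sum_ennreal
        sup_continuous_mult_left_ennreal sup_continuous_const sup_continuous_apply)
qed

lemma hitting_value_unfold:
  "hitting_value T r i = (if i \<in> T then 0 else r i + mean_next (hitting_value T r) i)"
proof -
  have "hitting_value T r = reward_op T r (hitting_value T r)"
    unfolding hitting_value_def
    by (rule lfp_unfold[OF sup_continuous_mono[OF sup_continuous_reward_op]])
  then show ?thesis by (metis reward_op_def)
qed

lemma hitting_value_le:
  assumes "\<And>i. i \<notin> T \<Longrightarrow> r i + mean_next u i \<le> u i"
  shows "hitting_value T r i \<le> u i"
proof -
  have "reward_op T r u \<le> u" using assms by (auto simp: le_fun_def reward_op_def)
  then have "hitting_value T r \<le> u" unfolding hitting_value_def by (rule lfp_lowerbound)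
  then show ?thesis by (simp add: le_fun_def)
qed

lemma hitting_value_eq_SUP: "hitting_value T r i = (SUP K. (reward_op T r ^^ K) bot i)"
  unfolding hitting_value_def sup_continuous_lfp[OF sup_continuous_reward_op] by (rule SUP_apply)

end

locale jump_process = finitely_branching_rates E q
  for E :: "'s set" and q :: "'s \<Rightarrow> 's \<Rightarrow> real" +
  fixes M :: "'w measure" and x :: 's and X :: "real \<Rightarrow> 'w \<Rightarrow> 's"
  assumes markov: "markov_jump_process M E q x X"
    and countable_states: "countable E" and start_in_states: "x \<in> E"
begin

sublocale prob_space M
  using markov by (simp add: markov_jump_process_def)

definition state :: "nat \<Rightarrow> 'w \<Rightarrow> 's" where
  "state k \<omega> = jump_chain (\<lambda>t. X t \<omega>) k"

definition hold :: "nat \<Rightarrow> 'w \<Rightarrow> real" where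
  "hold k \<omega> = holding_time (\<lambda>t. X t \<omega>) k"

text \<open>
  Histories list the states backwards. Positive holding times are included because the joint law of
  states and holding times is only given for events with strict lower bounds.
\<close>
definition history :: "'s list \<Rightarrow> 'w set" where
  "history h = {\<omega> \<in> space M. \<forall>j<length h. state j \<omega> = rev h ! j \<and> 0 < hold j \<omega>}"

lemma state_measurable: "state k \<in> M \<rightarrow>\<^sub>M count_space E"
  using markov by (auto simp: markov_jump_process_def state_def[abs_def])

lemma pred_state [measurable]: "Measurable.pred M (\<lambda>\<omega>. P (state k \<omega>))"
  by (rule measurable_compose[OF state_measurable]) simp

lemma hold_measurable [measurable]: "hold k \<in> borel_measurable M"
  using markov by (auto simp: markov_jump_process_def hold_def[abs_def])

lemma history_sets [measurable]: "history h \<in> sets M"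
  unfolding history_def by measurable

lemma in_history_Cons_iff:
  "\<omega> \<in> history (i # h) \<longleftrightarrow> \<omega> \<in> history h \<and> state (length h) \<omega> = i \<and> 0 < hold (length h) \<omega>"
  by (auto simp: history_def nth_append less_Suc_eq)

lemma prob_history_hold_product:
  assumes h: "set (i # h) \<subseteq> E" and s: "0 \<le> s"
  shows "prob {\<omega> \<in> history (i # h). s < hold (length h) \<omega>}
    = (if rev (i # h) ! 0 = x then 1 else 0)
      * (\<Prod>j<length h. jump_prob E q (rev (i # h) ! j) (rev (i # h) ! Suc j))
      * exp (- exit_rate E q i * s)"
proof -
  define k where "k = length h"
  define p where "p = rev (i # h)"
  define t where "t = (\<lambda>j. if j = k then s else 0)"
  have p_in: "p ! j \<in> E" if "j \<le> k" for j
    using that h nth_mem[of j p] by (auto simp: p_def k_def simp del: nth_mem)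
  have p_k: "p ! k = i" by (simp add: p_def k_def nth_append)
  have "{\<omega> \<in> history (i # h). s < hold k \<omega>}
      = {\<omega> \<in> space M. \<forall>j\<le>k. state j \<omega> = p ! j \<and> t j < hold j \<omega>}"
    unfolding history_def p_def[symmetric] using s
    by (auto simp: t_def k_def less_Suc_eq_le dest: le_less_trans split: if_splits)
  also have "prob \<dots> = (if p ! 0 = x then 1 else 0) * (\<Prod>j<k. jump_prob E q (p ! j) (p ! Suc j))
      * (\<Prod>j\<le>k. exp (- exit_rate E q (p ! j) * t j))"
  proof -
    have "\<forall>j\<le>k. 0 \<le> t j" using s by (simp add: t_def)
    then show ?thesis
      using markov p_in unfolding markov_jump_process_def state_def hold_def by blast
  qed
  also have "(\<Prod>j\<le>k. exp (- exit_rate E q (p ! j) * t j))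
      = (\<Prod>j\<in>{k}. exp (- exit_rate E q (p ! j) * t j))"
    by (rule prod.mono_neutral_right) (auto simp: t_def)
  finally show ?thesis
    unfolding p_def[symmetric] k_def[symmetric] by (simp add: p_k t_def)
qed

lemma history_hold_pos: "{\<omega> \<in> history (i # h). 0 < hold (length h) \<omega>} = history (i # h)"
  by (auto simp: in_history_Cons_iff)

lemma prob_history_hold:
  assumes "set (i # h) \<subseteq> E" "0 \<le> s"
  shows "prob {\<omega> \<in> history (i # h). s < hold (length h) \<omega>}
    = prob (history (i # h)) * exp (- exit_rate E q i * s)"
  using prob_history_hold_product[OF assms] prob_history_hold_product[OF assms(1), of 0]
  unfolding history_hold_pos by simp

lemma prob_history_Cons:
  assumes "set (j # i # h) \<subseteq> E"
  shows "prob (history (j # i # h)) = prob (history (i # h)) * jump_prob E q i j"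
proof -
  define p where "p = rev (i # h)"
  have p: "length p = Suc (length h)" "p ! length h = i" "rev (j # i # h) = p @ [j]"
    by (simp_all add: p_def nth_append)
  have "(\<Prod>l<Suc (length h). jump_prob E q ((p @ [j]) ! l) ((p @ [j]) ! Suc l))
      = (\<Prod>l<length h. jump_prob E q (p ! l) (p ! Suc l)) * jump_prob E q i j"
    by (simp add: p nth_append)
  moreover have "(p @ [j]) ! 0 = p ! 0" by (simp add: p nth_append)
  ultimately show ?thesis
    using prob_history_hold_product[of i h 0] prob_history_hold_product[of j "i # h" 0] assms
    unfolding history_hold_pos p(3) p_def[symmetric] by simp
qed

lemma AE_history_start: "AE \<omega> in M. \<omega> \<in> history [x]"
proof -
  have "prob (history [x]) = 1"
    using prob_history_hold_product[of x "[]" 0] start_in_states unfolding history_hold_pos by simp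
  then show ?thesis by (simp only: prob_eq_1[OF history_sets])
qed

lemma AE_history_step:
  assumes h: "set (i # h) \<subseteq> E"
  shows "AE \<omega> in M. \<omega> \<in> history (i # h) \<longrightarrow> (\<exists>j\<in>successors E q i. \<omega> \<in> history (j # i # h))"
proof -
  define U where "U = (\<Union>j\<in>successors E q i. history (j # i # h))"
  have i: "i \<in> E" using h by simp
  have U_sets: "U \<in> sets M" unfolding U_def using finite_successors[OF i] by auto
  have "prob U = (\<Sum>j\<in>successors E q i. prob (history (j # i # h)))"
    unfolding U_def using finite_successors[OF i]
    by (intro finite_measure_finite_Union) (auto simp: disjoint_family_on_def in_history_Cons_iff)
  also have "\<dots> = (\<Sum>j\<in>successors E q i. prob (history (i # h)) * jump_prob E q i j)"
    using h by (intro sum.cong refl prob_history_Cons) (auto simp: successors_def)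
  also have "\<dots> = prob (history (i # h))"
    by (simp only: sum_distrib_left[symmetric] sum_jump_prob[OF i] mult_1_right)
  finally have "prob (history (i # h) - U) = 0"
    using U_sets by (subst finite_measure_Diff) (auto simp: U_def in_history_Cons_iff)
  then have "AE \<omega> in M. \<omega> \<notin> history (i # h) - U"
    using U_sets by (intro AE_not_in) (auto simp: null_sets_def emeasure_eq_measure)
  then show ?thesis by eventually_elim (auto simp: U_def)
qed

primrec possible_histories :: "nat \<Rightarrow> 's list set" where
  "possible_histories 0 = {[x]}"
| "possible_histories (Suc k)
     = (\<Union>h\<in>possible_histories k. (\<lambda>j. j # h) ` successors E q (hd h))"

lemma possible_historiesD:
  "h \<in> possible_histories k \<Longrightarrow> length h = Suc k \<and> set h \<subseteq> E"
  by (induction k arbitrary: h) (force simp: start_in_states successors_def)+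

lemma finite_possible_histories: "finite (possible_histories k)"
proof (induction k)
  case (Suc k)
  have "hd h \<in> E" if "h \<in> possible_histories k" for h
    using possible_historiesD[OF that] by (cases h) auto
  then show ?case using Suc finite_successors by simp
qed simp

lemma AE_possible_history: "AE \<omega> in M. \<exists>h\<in>possible_histories k. \<omega> \<in> history h"
proof (induction k)
  case 0
  then show ?case using AE_history_start by simp
next
  case (Suc k)
  have "AE \<omega> in M. \<forall>h\<in>possible_histories k. \<omega> \<in> history h \<longrightarrow>
      (\<exists>j\<in>successors E q (hd h). \<omega> \<in> history (j # h))"
  proof (rule AE_finite_allI[OF finite_possible_histories])
    fix h assume "h \<in> possible_histories k"
    then obtain i h' where "h = i # h'" "set (i # h') \<subseteq> E"
      using possible_historiesD[of h k] by (cases h) auto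
    then show "AE \<omega> in M. \<omega> \<in> history h \<longrightarrow>
        (\<exists>j\<in>successors E q (hd h). \<omega> \<in> history (j # h))"
      using AE_history_step[of i h'] by simp
  qed
  with Suc show ?case
  proof eventually_elim
    case (elim \<omega>)
    then obtain h j
      where "h \<in> possible_histories k" "j \<in> successors E q (hd h)" "\<omega> \<in> history (j # h)"
      by blast
    then show ?case by (intro bexI[of _ "j # h"]) auto
  qed
qed

lemma AE_jumps:
  "AE \<omega> in M. state 0 \<omega> = x \<and>
     (\<forall>k. 0 < hold k \<omega> \<and> state (Suc k) \<omega> \<in> successors E q (state k \<omega>))"
proof -
  have "AE \<omega> in M. \<forall>k. \<exists>h\<in>possible_histories k. \<omega> \<in> history h"
    using AE_possible_history by (subst AE_all_countable) blast
  then show ?thesis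
  proof eventually_elim
    case (elim \<omega>)
    have "0 < hold k \<omega> \<and> state (Suc k) \<omega> \<in> successors E q (state k \<omega>)" for k
    proof -
      obtain h j
        where h: "h \<in> possible_histories k" "j \<in> successors E q (hd h)" "\<omega> \<in> history (j # h)"
        using elim[rule_format, of "Suc k"] by auto
      moreover obtain i h' where "h = i # h'" "length h' = k"
        using possible_historiesD[OF h(1)] by (cases h) auto
      ultimately show ?thesis by (auto simp: in_history_Cons_iff)
    qed
    moreover have "state 0 \<omega> = x" using elim[rule_format, of 0] by (simp add: in_history_Cons_iff)
    ultimately show ?case by blast
  qed
qed

lemma nn_integral_history_split:
  assumes h: "set (i # h) \<subseteq> E" and f [measurable]: "f \<in> borel_measurable M"
  shows "(\<integral>\<^sup>+\<omega>\<in>history (i # h). f \<omega> \<partial>M)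
    = (\<Sum>j\<in>successors E q i. \<integral>\<^sup>+\<omega>\<in>history (j # i # h). f \<omega> \<partial>M)"
proof -
  have fin: "finite (successors E q i)" using h by (auto intro: finite_successors)
  have "(\<integral>\<^sup>+\<omega>\<in>history (i # h). f \<omega> \<partial>M)
    = (\<integral>\<^sup>+\<omega>. (\<Sum>j\<in>successors E q i. f \<omega> * indicator (history (j # i # h)) \<omega>) \<partial>M)"
  proof (rule nn_integral_cong_AE, use AE_history_step[OF h] in eventually_elim)
    case (elim \<omega>)
    have "(\<Sum>j\<in>successors E q i. indicator (history (j # i # h)) \<omega> :: ennreal)
        = indicator (\<Union>j\<in>successors E q i. history (j # i # h)) \<omega>"
      using fin by (intro indicator_UN_disjoint[symmetric])
        (auto simp: disjoint_family_on_def in_history_Cons_iff)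
    also have "\<dots> = indicator (history (i # h)) \<omega>"
      using elim by (auto simp: indicator_def in_history_Cons_iff)
    finally show ?case by (simp add: sum_distrib_left[symmetric])
  qed
  also have "\<dots> = (\<Sum>j\<in>successors E q i. \<integral>\<^sup>+\<omega>\<in>history (j # i # h). f \<omega> \<partial>M)"
    by (rule nn_integral_sum) measurable
  finally show ?thesis .
qed

lemma emeasure_history_Cons:
  assumes "set (j # i # h) \<subseteq> E"
  shows "emeasure M (history (j # i # h))
    = emeasure M (history (i # h)) * ennreal (jump_prob E q i j)"
  unfolding emeasure_eq_measure prob_history_Cons[OF assms]
  using assms by (intro ennreal_mult) (auto simp: jump_prob_nonneg)

lemma nn_integral_history_mean_next:
  assumes h: "set (i # h) \<subseteq> E" and f: "f \<in> borel_measurable M"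
    and mean: "\<And>j. j \<in> successors E q i \<Longrightarrow>
      (\<integral>\<^sup>+\<omega>\<in>history (j # i # h). f \<omega> \<partial>M) = emeasure M (history (j # i # h)) * u j"
  shows "(\<integral>\<^sup>+\<omega>\<in>history (i # h). f \<omega> \<partial>M) = emeasure M (history (i # h)) * mean_next u i"
proof -
  have "(\<integral>\<^sup>+\<omega>\<in>history (i # h). f \<omega> \<partial>M)
      = (\<Sum>j\<in>successors E q i. emeasure M (history (j # i # h)) * u j)"
    unfolding nn_integral_history_split[OF h f] by (intro sum.cong refl mean)
  also have "\<dots> = (\<Sum>j\<in>successors E q i.
      emeasure M (history (i # h)) * (ennreal (jump_prob E q i j) * u j))"
    using h by (intro sum.cong refl) (simp add: emeasure_history_Cons successors_def mult.assoc)
  finally show ?thesis by (simp add: mean_next_def sum_distrib_left)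
qed

lemma distributed_hold_given_history:
  assumes h: "set (i # h) \<subseteq> E" and pos: "prob (history (i # h)) \<noteq> 0"
  shows "distributed (uniform_measure M (history (i # h))) lborel (hold (length h))
    (exponential_density (exit_rate E q i))"
proof -
  let ?A = "history (i # h)" and ?T = "hold (length h)"
  have rate: "0 < exit_rate E q i" using h by (simp add: exit_rate_pos)
  show ?thesis
  proof (rule exponential_distributedI)
    show "0 < exit_rate E q i" by (rule rate)
  next
    fix s :: real
    assume s: "0 \<le> s"
    have "?A \<subseteq> space M" by (auto simp: history_def)
    then have "?A \<inter> {\<omega> \<in> space M. ?T \<omega> \<le> s} = ?A - {\<omega> \<in> ?A. s < ?T \<omega>}"
      and "{\<omega> \<in> ?A. s < ?T \<omega>} = ?A \<inter> {\<omega> \<in> space M. s < ?T \<omega>}"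
      by auto
    moreover from this(2) have "{\<omega> \<in> ?A. s < ?T \<omega>} \<in> sets M" by simp
    ultimately have "prob (?A \<inter> {\<omega> \<in> space M. ?T \<omega> \<le> s})
        = prob ?A * (1 - exp (- s * exit_rate E q i))"
      using prob_history_hold[OF h s]
      by (simp add: finite_measure_Diff algebra_simps)
    moreover have "0 < prob ?A" using pos by (simp add: zero_less_measure_iff)
    moreover have "0 \<le> 1 - exp (- s * exit_rate E q i)" using s rate by simp
    ultimately have "emeasure (uniform_measure M ?A) {\<omega> \<in> space M. ?T \<omega> \<le> s}
        = ennreal (1 - exp (- s * exit_rate E q i))"
      by (simp add: emeasure_eq_measure divide_ennreal)
    then show "emeasure (uniform_measure M ?A) {\<omega> \<in> space (uniform_measure M ?A). ?T \<omega> \<le> s}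
        = 1 - ennreal (exp (- s * exit_rate E q i))"
      using ennreal_minus[of "exp (- s * exit_rate E q i)" 1] by simp
  qed measurable
qed

lemma nn_integral_hold_history:
  assumes h: "set (i # h) \<subseteq> E"
  shows "(\<integral>\<^sup>+\<omega>\<in>history (i # h). ennreal (hold (length h) \<omega>) \<partial>M)
    = emeasure M (history (i # h)) * ennreal (1 / exit_rate E q i)"
proof (cases "prob (history (i # h)) = 0")
  case True
  then have "AE \<omega> in M. \<omega> \<notin> history (i # h)"
    by (intro AE_not_in) (auto simp: null_sets_def emeasure_eq_measure)
  then have "(\<integral>\<^sup>+\<omega>\<in>history (i # h). ennreal (hold (length h) \<omega>) \<partial>M) = (\<integral>\<^sup>+\<omega>. 0 \<partial>M)"
    by (intro nn_integral_cong_AE) (auto elim: eventually_mono)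
  then show ?thesis using True by (simp add: emeasure_eq_measure)
next
  case False
  define U where "U = uniform_measure M (history (i # h))"
  have rate: "0 < exit_rate E q i" using h by (simp add: exit_rate_pos)
  have "(\<integral>\<^sup>+\<omega>. ennreal (hold (length h) \<omega>) \<partial>U)
      = (\<integral>\<^sup>+s. ennreal (exponential_density (exit_rate E q i) s) * ennreal s \<partial>lborel)"
    using distributed_hold_given_history[OF h False]
    by (intro distributed_nn_integral[symmetric]) (auto simp: U_def)
  also have "\<dots> = (\<integral>\<^sup>+s. ennreal (erlang_density 0 (exit_rate E q i) s * s ^ 1) \<partial>lborel)"
    using rate by (intro nn_integral_cong) (simp add: ennreal_mult' erlang_density_nonneg)
  also have "\<dots> = ennreal (1 / exit_rate E q i)"
    using nn_integral_erlang_ith_moment[OF rate, of 0 1] by simp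
  finally have mean: "(\<integral>\<^sup>+\<omega>. ennreal (hold (length h) \<omega>) \<partial>U) = ennreal (1 / exit_rate E q i)" .
  let ?I = "\<integral>\<^sup>+\<omega>\<in>history (i # h). ennreal (hold (length h) \<omega>) \<partial>M"
  have "emeasure M (history (i # h)) \<noteq> 0" "emeasure M (history (i # h)) \<noteq> top"
    using False by (auto simp: emeasure_eq_measure)
  then have "?I = emeasure M (history (i # h)) * (?I / emeasure M (history (i # h)))"
    by (subst ennreal_times_divide, subst mult.commute) (simp add: mult_divide_eq_ennreal)
  also have "?I / emeasure M (history (i # h)) = (\<integral>\<^sup>+\<omega>. ennreal (hold (length h) \<omega>) \<partial>U)"
    unfolding U_def by (rule nn_integral_uniform_measure[symmetric]) measurable
  finally show ?thesis by (simp only: mean)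
qed

lemma nn_integral_jump_history:
  assumes h: "set (i # h) \<subseteq> E"
    and g: "(\<lambda>\<omega>. g (state (length h) \<omega>) (state (Suc (length h)) \<omega>)) \<in> borel_measurable M"
  shows "(\<integral>\<^sup>+\<omega>\<in>history (i # h). g (state (length h) \<omega>) (state (Suc (length h)) \<omega>) \<partial>M)
    = emeasure M (history (i # h)) * mean_next (g i) i"
proof (rule nn_integral_history_mean_next[OF h g])
  fix j
  have "(\<integral>\<^sup>+\<omega>\<in>history (j # i # h). g (state (length h) \<omega>) (state (Suc (length h)) \<omega>) \<partial>M)
      = (\<integral>\<^sup>+\<omega>\<in>history (j # i # h). g i j \<partial>M)"
    by (intro nn_integral_cong) (auto simp: indicator_def in_history_Cons_iff)
  then show "(\<integral>\<^sup>+\<omega>\<in>history (j # i # h). g (state (length h) \<omega>) (state (Suc (length h)) \<omega>) \<partial>M)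
      = emeasure M (history (j # i # h)) * g i j"
    by (simp add: nn_integral_cmult mult.commute)
qed

definition reward_within :: "'s set \<Rightarrow> (nat \<Rightarrow> 'w \<Rightarrow> ennreal) \<Rightarrow> nat \<Rightarrow> nat \<Rightarrow> 'w \<Rightarrow> ennreal" where
  "reward_within T R K k \<omega> = (\<Sum>j<K. if \<forall>l\<le>j. state (k + l) \<omega> \<notin> T then R (k + j) \<omega> else 0)"

definition total_reward :: "'s set \<Rightarrow> (nat \<Rightarrow> 'w \<Rightarrow> ennreal) \<Rightarrow> 'w \<Rightarrow> ennreal" where
  "total_reward T R \<omega> = (\<Sum>k. if \<forall>l\<le>k. state l \<omega> \<notin> T then R k \<omega> else 0)"

lemma reward_within_measurable [measurable]:
  assumes [measurable]: "\<And>k. R k \<in> borel_measurable M"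
  shows "reward_within T R K k \<in> borel_measurable M"
  unfolding reward_within_def by measurable

lemma reward_within_Suc:
  "reward_within T R (Suc K) k \<omega>
    = (if state k \<omega> \<in> T then 0 else R k \<omega> + reward_within T R K (Suc k) \<omega>)"
proof -
  have "(\<forall>l\<le>Suc j. state (k + l) \<omega> \<notin> T) \<longleftrightarrow> state k \<omega> \<notin> T \<and> (\<forall>l\<le>j. state (Suc k + l) \<omega> \<notin> T)" for j
    by (simp add: less_Suc_eq_le[symmetric] All_less_Suc2)
  then show ?thesis
    unfolding reward_within_def sum.lessThan_Suc_shift by (simp cong: if_cong)
qed

lemma total_reward_eq_SUP: "total_reward T R \<omega> = (SUP K. reward_within T R K 0 \<omega>)"
  by (simp add: total_reward_def reward_within_def suminf_eq_SUP cong: if_cong)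

lemma total_reward_eq_sum:
  assumes "state H \<omega> \<in> T" and before: "\<And>k. k < H \<Longrightarrow> state k \<omega> \<notin> T"
  shows "total_reward T R \<omega> = (\<Sum>k<H. R k \<omega>)"
proof -
  have "total_reward T R \<omega> = (\<Sum>k<H. if \<forall>l\<le>k. state l \<omega> \<notin> T then R k \<omega> else 0)"
    unfolding total_reward_def using assms(1) by (intro suminf_finite) (auto simp: not_less)
  also have "\<dots> = (\<Sum>k<H. R k \<omega>)" using before by (intro sum.cong) auto
  finally show ?thesis .
qed

context
  fixes T :: "'s set" and R :: "nat \<Rightarrow> 'w \<Rightarrow> ennreal" and r :: "'s \<Rightarrow> ennreal"
  assumes R_measurable [measurable]: "\<And>k. R k \<in> borel_measurable M"
    and mean: "\<And>i h. set (i # h) \<subseteq> E \<Longrightarrow>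
      (\<integral>\<^sup>+\<omega>\<in>history (i # h). R (length h) \<omega> \<partial>M) = emeasure M (history (i # h)) * r i"
begin

lemma nn_integral_reward_within_Suc_history:
  assumes h: "set (i # h) \<subseteq> E"
  shows "(\<integral>\<^sup>+\<omega>\<in>history (i # h). reward_within T R (Suc K) (length h) \<omega> \<partial>M)
    = (if i \<in> T then 0 else emeasure M (history (i # h)) * r i
        + (\<integral>\<^sup>+\<omega>\<in>history (i # h). reward_within T R K (Suc (length h)) \<omega> \<partial>M))"
proof (cases "i \<in> T")
  case True
  then have "(\<integral>\<^sup>+\<omega>\<in>history (i # h). reward_within T R (Suc K) (length h) \<omega> \<partial>M) = (\<integral>\<^sup>+\<omega>. 0 \<partial>M)"
    by (intro nn_integral_cong) (auto simp: reward_within_Suc indicator_def in_history_Cons_iff)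
  then show ?thesis using True by simp
next
  case False
  then have "(\<integral>\<^sup>+\<omega>\<in>history (i # h). reward_within T R (Suc K) (length h) \<omega> \<partial>M)
      = (\<integral>\<^sup>+\<omega>. R (length h) \<omega> * indicator (history (i # h)) \<omega>
          + reward_within T R K (Suc (length h)) \<omega> * indicator (history (i # h)) \<omega> \<partial>M)"
    by (intro nn_integral_cong) (auto simp: reward_within_Suc indicator_def in_history_Cons_iff)
  also have "\<dots> = (\<integral>\<^sup>+\<omega>\<in>history (i # h). R (length h) \<omega> \<partial>M)
      + (\<integral>\<^sup>+\<omega>\<in>history (i # h). reward_within T R K (Suc (length h)) \<omega> \<partial>M)"
    by (rule nn_integral_add) measurable
  finally show ?thesis using False by (simp add: mean[OF h])
qed

lemma nn_integral_reward_within_history: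
  assumes "set (i # h) \<subseteq> E"
  shows "(\<integral>\<^sup>+\<omega>\<in>history (i # h). reward_within T R K (length h) \<omega> \<partial>M)
    = emeasure M (history (i # h)) * (reward_op T r ^^ K) bot i"
  using assms
proof (induction K arbitrary: i h)
  case 0
  then show ?case by (simp add: reward_within_def bot_ennreal)
next
  case (Suc K)
  define u where "u = (reward_op T r ^^ K) bot"
  have "(\<integral>\<^sup>+\<omega>\<in>history (i # h). reward_within T R K (Suc (length h)) \<omega> \<partial>M)
      = emeasure M (history (i # h)) * mean_next u i"
  proof (rule nn_integral_history_mean_next[OF Suc.prems])
    fix j assume "j \<in> successors E q i"
    then have "set (j # i # h) \<subseteq> E" using Suc.prems by (auto simp: successors_def)
    from Suc.IH[OF this]
    show "(\<integral>\<^sup>+\<omega>\<in>history (j # i # h). reward_within T R K (Suc (length h)) \<omega> \<partial>M)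
        = emeasure M (history (j # i # h)) * u j"
      by (simp only: u_def list.size add_Suc_right add_0_right)
  qed measurable
  then have "(\<integral>\<^sup>+\<omega>\<in>history (i # h). reward_within T R (Suc K) (length h) \<omega> \<partial>M)
      = emeasure M (history (i # h)) * reward_op T r u i"
    by (simp add: nn_integral_reward_within_Suc_history[OF Suc.prems] reward_op_def distrib_left)
  then show ?case by (simp only: u_def funpow.simps o_apply)
qed

lemma nn_integral_total_reward: "(\<integral>\<^sup>+\<omega>. total_reward T R \<omega> \<partial>M) = hitting_value T r x"
proof -
  have within: "(\<integral>\<^sup>+\<omega>. reward_within T R K 0 \<omega> \<partial>M) = (reward_op T r ^^ K) bot x" for K
  proof -
    have "(\<integral>\<^sup>+\<omega>. reward_within T R K 0 \<omega> \<partial>M) = (\<integral>\<^sup>+\<omega>\<in>history [x]. reward_within T R K 0 \<omega> \<partial>M)"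
      using AE_history_start by (intro nn_integral_cong_AE) (auto elim: eventually_mono)
    moreover have "emeasure M (history [x]) = 1"
      using AE_history_start by (simp only: emeasure_eq_1_AE[OF history_sets])
    ultimately show ?thesis
      using nn_integral_reward_within_history[of x "[]" K] start_in_states by simp
  qed
  have "(\<integral>\<^sup>+\<omega>. total_reward T R \<omega> \<partial>M) = (SUP K. \<integral>\<^sup>+\<omega>. reward_within T R K 0 \<omega> \<partial>M)"
    unfolding total_reward_eq_SUP
    by (rule nn_integral_monotone_convergence_SUP)
      (auto simp: reward_within_def[abs_def] intro!: incseq_SucI le_funI)
  then show ?thesis by (simp only: within hitting_value_eq_SUP)
qed

end

corollary nn_integral_total_hold:
  "(\<integral>\<^sup>+\<omega>. total_reward T (\<lambda>k \<omega>. ennreal (hold k \<omega>)) \<omega> \<partial>M)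
    = hitting_value T (\<lambda>i. ennreal (1 / exit_rate E q i)) x"
  by (intro nn_integral_total_reward nn_integral_hold_history) measurable

corollary nn_integral_total_jump_reward:
  "(\<integral>\<^sup>+\<omega>. total_reward T (\<lambda>k \<omega>. g (state k \<omega>) (state (Suc k) \<omega>)) \<omega> \<partial>M)
    = hitting_value T (\<lambda>i. mean_next (g i) i) x"
proof (rule nn_integral_total_reward)
  show "(\<lambda>\<omega>. g (state k \<omega>) (state (Suc k) \<omega>)) \<in> borel_measurable M" for k
    by (rule measurable_compose_countable'[OF _ state_measurable countable_states])
      (rule measurable_compose[OF state_measurable], simp)
  then show "(\<integral>\<^sup>+\<omega>\<in>history (i # h). g (state (length h) \<omega>) (state (Suc (length h)) \<omega>) \<partial>M)
      = emeasure M (history (i # h)) * mean_next (g i) i" if "set (i # h) \<subseteq> E" for i h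
    using that by (intro nn_integral_jump_history)
qed

corollary AE_hits:
  assumes finite: "hitting_value T (\<lambda>_. 1) x < \<infinity>"
  shows "AE \<omega> in M. \<exists>k. state k \<omega> \<in> T"
proof -
  have "(\<integral>\<^sup>+\<omega>. total_reward T (\<lambda>_ _. 1) \<omega> \<partial>M) = hitting_value T (\<lambda>_. 1) x"
    by (rule nn_integral_total_reward) simp_all
  moreover have "total_reward T (\<lambda>_ _. 1) \<in> borel_measurable M"
    unfolding total_reward_def by measurable
  ultimately have "AE \<omega> in M. total_reward T (\<lambda>_ _. 1) \<omega> \<noteq> \<infinity>"
    using finite by (intro nn_integral_PInf_AE) auto
  then show ?thesis
  proof eventually_elim
    case (elim \<omega>)
    show ?case
    proof (rule ccontr)
      assume "\<nexists>k. state k \<omega> \<in> T"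
      then have "reward_within T (\<lambda>_ _. 1) K 0 \<omega> = of_nat K" for K
        by (simp add: reward_within_def)
      then have "total_reward T (\<lambda>_ _. 1) \<omega> = \<infinity>"
        by (simp add: total_reward_eq_SUP ennreal_SUP_of_nat_eq_top)
      then show False using elim by simp
    qed
  qed
qed

end

section \<open>Hitting times of a sample path\<close>

locale jump_path =
  fixes x :: "real \<Rightarrow> 's"
  assumes holding_time_pos: "0 < holding_time x k"
begin

lemma strict_mono_jump_time: "strict_mono (jump_time x)"
  using holding_time_pos by (intro strict_monoI_Suc) (simp add: holding_time_def)

lemma jump_time_nonneg: "0 \<le> jump_time x k"
  using strict_mono_less_eq[OF strict_mono_jump_time, of 0 k] by simp

lemma jump_time_eq_sum: "jump_time x k = (\<Sum>j<k. holding_time x j)"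
  by (induction k) (simp_all add: holding_time_def del: jump_time.simps(2))

lemma constant_between_jumps:
  assumes "jump_time x k \<le> t" "t < jump_time x (Suc k)"
  shows "x t = jump_chain x k"
proof (rule ccontr)
  assume ne: "x t \<noteq> jump_chain x k"
  then have "jump_time x k < t"
    using assms(1) by (cases "t = jump_time x k") (auto simp: jump_chain_def)
  then have "jump_time x (Suc k) \<le> t"
    using ne by (auto simp: jump_chain_def intro!: cInf_lower bdd_belowI[of _ "jump_time x k"])
  then show False using assms(2) by simp
qed

lemma hitting_time_eq_jump_time:
  assumes hit: "jump_chain x H \<in> T" and before: "\<And>k. k < H \<Longrightarrow> jump_chain x k \<notin> T"
  shows "Inf (ennreal ` {t. 0 \<le> t \<and> x t \<in> T}) = ennreal (jump_time x H)"
proof (rule antisym)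
  show "Inf (ennreal ` {t. 0 \<le> t \<and> x t \<in> T}) \<le> ennreal (jump_time x H)"
    using jump_time_nonneg hit by (intro Inf_lower) (auto simp: jump_chain_def)
  have "jump_time x H \<le> t" if t: "0 \<le> t" "x t \<in> T" for t
  proof (rule ccontr)
    assume "\<not> jump_time x H \<le> t"
    then obtain k where k: "k < H" "\<forall>i\<le>k. \<not> t < jump_time x i" "t < jump_time x (Suc k)"
      using ex_least_nat_less[of "\<lambda>k. t < jump_time x k" H] t(1) by auto
    then have "x t = jump_chain x k" by (intro constant_between_jumps) auto
    then show False using before[OF k(1)] t(2) by simp
  qed
  then show "ennreal (jump_time x H) \<le> Inf (ennreal ` {t. 0 \<le> t \<and> x t \<in> T})"
    by (intro Inf_greatest) (auto intro: ennreal_leI)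
qed

end

section \<open>The area under a staircase\<close>

lemma closed_segment_Pair_fst: "closed_segment (x, y) (x, y') = {x} \<times> closed_segment y y'"
  for x :: "'a::real_vector" and y y' :: "'b::real_vector"
  by (auto simp: closed_segment_def scaleR_left_distrib[symmetric])

lemma closed_segment_Pair_snd: "closed_segment (x, y) (x', y) = closed_segment x x' \<times> {y}"
  for x x' :: "'a::real_vector" and y :: "'b::real_vector"
  by (auto simp: closed_segment_def scaleR_left_distrib[symmetric])

lemma emeasure_lborel_Times:
  fixes A :: "'a::euclidean_space set" and B :: "'b::euclidean_space set"
  assumes "A \<in> sets borel" "B \<in> sets borel"
  shows "emeasure lborel (A \<times> B) = emeasure lborel A * emeasure lborel B"
  using lborel.emeasure_pair_measure_Times[of A lborel B] assms by (simp add: lborel_prod)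

locale staircase =
  fixes a b :: "nat \<Rightarrow> real" and H :: nat
  assumes b_0: "b 0 = 0" and a_H: "a H = 0"
    and moves: "\<And>k. k < H \<Longrightarrow>
      a (Suc k) = a k \<and> b k \<le> b (Suc k) \<or> a (Suc k) \<le> a k \<and> b (Suc k) = b k"
begin

definition stairs :: "(real \<times> real) set" where
  "stairs = (\<Union>k<H. closed_segment (a k, b k) (a (Suc k), b (Suc k)))"

text \<open>Boxes anchored at \<open>(0, 0)\<close> make this a down-set; a diagonal ray that leaves it never returns.\<close>
definition polygon :: "(real \<times> real) set" where
  "polygon = (\<Union>k<H. {0..a k} \<times> {0..b (Suc k)})"

definition cells :: "(real \<times> real) set" where
  "cells = (\<Union>k<H. {0<..<a k} \<times> {b k<..<b (Suc k)})"

definition axes :: "(real \<times> real) set" where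
  "axes = {p. fst p = 0 \<or> snd p = 0}"

definition region :: "(real \<times> real) set" where
  "region = {p. 0 < fst p \<and> 0 < snd p} \<inter> inside (axes \<union> stairs)"

lemma a_antimono: "j \<le> k \<Longrightarrow> k \<le> H \<Longrightarrow> a k \<le> a j"
proof (induction k rule: dec_induct)
  case (step m)
  then show ?case using moves[of m] by auto
qed simp

lemma b_mono: "j \<le> k \<Longrightarrow> k \<le> H \<Longrightarrow> b j \<le> b k"
proof (induction k rule: dec_induct)
  case (step m)
  then show ?case using moves[of m] by auto
qed simp

lemma a_nonneg: "k \<le> H \<Longrightarrow> 0 \<le> a k"
  using a_antimono[of k H] a_H by simp

lemma b_nonneg: "k \<le> H \<Longrightarrow> 0 \<le> b k"
  using b_mono[of 0 k] b_0 by simp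

lemma vertical_segment:
  assumes "k < H" "a (Suc k) = a k"
  shows "closed_segment (a k, b k) (a (Suc k), b (Suc k)) = {a k} \<times> {b k..b (Suc k)}"
  using assms b_mono[of k "Suc k"]
  by (auto simp: closed_segment_Pair_fst closed_segment_eq_real_ivl)

lemma horizontal_segment:
  assumes "k < H" "b (Suc k) = b k"
  shows "closed_segment (a k, b k) (a (Suc k), b (Suc k)) = {a (Suc k)..a k} \<times> {b k}"
  using assms a_antimono[of k "Suc k"]
  by (auto simp: closed_segment_Pair_snd closed_segment_eq_real_ivl)

lemma in_stairsE:
  assumes "(x, y) \<in> stairs"
  obtains (vertical) k where "k < H" "x = a k" "b k \<le> y" "y \<le> b (Suc k)"
    | (horizontal) k where "k < H" "a (Suc k) \<le> x" "x \<le> a k" "y = b k" "b (Suc k) = b k"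
proof -
  obtain k where k: "k < H" "(x, y) \<in> closed_segment (a k, b k) (a (Suc k), b (Suc k))"
    using assms by (auto simp: stairs_def)
  from moves[OF k(1)] show ?thesis
  proof
    assume "a (Suc k) = a k \<and> b k \<le> b (Suc k)"
    then show ?thesis using k vertical_segment[OF k(1)] by (intro vertical[of k]) auto
  next
    assume "a (Suc k) \<le> a k \<and> b (Suc k) = b k"
    then show ?thesis using k horizontal_segment[OF k(1)] by (intro horizontal[of k]) auto
  qed
qed

lemma vertical_crossing:
  assumes "0 \<le> y" "y < b m" "m \<le> H"
  obtains k where "k < m" "b k \<le> y" "y < b (Suc k)" "a (Suc k) = a k"
proof -
  obtain k where k: "k < m" "\<forall>i\<le>k. \<not> y < b i" "y < b (Suc k)"
    using ex_least_nat_less[of "\<lambda>k. y < b k" m] assms b_0 by auto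
  then have "b k \<le> y" by (simp add: not_less)
  then show ?thesis using k moves[of k] assms(3) by (intro that[of k]) auto
qed

lemma horizontal_crossing:
  assumes "0 < x" "x \<le> a m" "m < H"
  obtains k where "k < H" "m \<le> k" "a (Suc k) < x" "x \<le> a k" "b (Suc k) = b k"
proof -
  have "x \<le> a 0" using assms a_antimono[of 0 m] by simp
  then obtain k where k: "k < H" "\<forall>i\<le>k. \<not> a i < x" "a (Suc k) < x"
    using ex_least_nat_less[of "\<lambda>k. a k < x" H] assms a_H by auto
  have "m \<le> k"
  proof (rule ccontr)
    assume "\<not> m \<le> k"
    then have "a m \<le> a (Suc k)" using a_antimono[of "Suc k" m] assms by simp
    then show False using assms k by simp
  qed
  then show ?thesis using k moves[of k] by (intro that[of k]) auto
qed

lemma stairs_subset_polygon: "stairs \<subseteq> polygon"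
proof clarify
  fix x y assume "(x, y) \<in> stairs"
  then show "(x, y) \<in> polygon"
  proof (cases rule: in_stairsE)
    case (vertical k)
    then show ?thesis
      using a_nonneg[of k] b_nonneg[of k] by (auto simp: polygon_def)
  next
    case (horizontal k)
    then show ?thesis
      using a_nonneg[of "Suc k"] b_nonneg[of k] by (force simp: polygon_def)
  qed
qed

lemma cells_disjoint_stairs: "cells \<inter> stairs = {}"
proof (rule ccontr)
  assume "cells \<inter> stairs \<noteq> {}"
  then obtain x y k where k: "k < H" "x < a k" "b k < y" "y < b (Suc k)"
    and stairs: "(x, y) \<in> stairs"
    by (auto simp: cells_def)
  have order: "b (Suc i) \<le> b k \<or> i = k \<or> b (Suc k) \<le> b i" if "i < H" for i
    using b_mono[of "Suc i" k] b_mono[of "Suc k" i] that k(1)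
    by (cases i k rule: linorder_cases) auto
  from stairs show False
  proof (cases rule: in_stairsE)
    case (vertical i)
    then show ?thesis using order[of i] k by auto
  next
    case (horizontal i)
    then show ?thesis using order[of i] k by auto
  qed
qed

lemma cells_subset_polygon: "cells \<subseteq> polygon"
  unfolding cells_def polygon_def using b_nonneg
  by (intro UN_mono order_refl Sigma_mono) (fastforce dest: less_imp_le_nat)+

lemma polygon_interior_point:
  assumes polygon: "(x, y) \<in> polygon" and pos: "0 < x" "0 < y" and off: "(x, y) \<notin> stairs"
  obtains k where "k < H" "x < a k" "y < b (Suc k)"
proof -
  obtain m where m: "m < H" "x \<le> a m" "y \<le> b (Suc m)"
    using polygon by (auto simp: polygon_def)
  obtain k where k: "k < H" "m \<le> k" "a (Suc k) < x" "x \<le> a k" "b (Suc k) = b k"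
    using horizontal_crossing[OF pos(1) m(2,1)] .
  have "y \<noteq> b k"
  proof
    assume "y = b k"
    then have "(x, y) \<in> closed_segment (a k, b k) (a (Suc k), b (Suc k))"
      unfolding horizontal_segment[OF k(1,5)] using k by simp
    then show False using off k(1) by (auto simp: stairs_def)
  qed
  moreover have "y \<le> b k" using b_mono[of "Suc m" "Suc k"] m k by simp
  ultimately have "y < b k" by simp
  then obtain j where j: "j < k" "b j \<le> y" "y < b (Suc j)" "a (Suc j) = a j"
    using vertical_crossing[of y k] pos k(1) by auto
  have "x \<noteq> a j"
  proof
    assume "x = a j"
    moreover have "j < H" using j(1) k(1) by simp
    ultimately have "(x, y) \<in> closed_segment (a j, b j) (a (Suc j), b (Suc j))"
      using vertical_segment[OF _ j(4)] j by simp
    then show False using off j(1) k(1) by (auto simp: stairs_def)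
  qed
  moreover have "x \<le> a j" using a_antimono[of j k] j k by simp
  ultimately show ?thesis using that[of j] j k by simp
qed

lemma frontier_polygon_subset: "frontier polygon \<subseteq> axes \<union> stairs"
proof clarify
  fix x y assume frontier: "(x, y) \<in> frontier polygon" and off: "(x, y) \<notin> stairs"
  have "closed polygon" unfolding polygon_def by (intro closed_UN) (auto intro!: closed_Times)
  then have polygon: "(x, y) \<in> polygon" "(x, y) \<notin> interior polygon"
    using frontier by (auto simp: frontier_def)
  show "(x, y) \<in> axes"
  proof (rule ccontr)
    assume "(x, y) \<notin> axes"
    then have pos: "0 < x" "0 < y" using polygon(1) by (auto simp: polygon_def axes_def)
    obtain k where k: "k < H" "x < a k" "y < b (Suc k)"
      using polygon_interior_point[OF polygon(1) pos off] .
    have "{0<..<a k} \<times> {0<..<b (Suc k)} \<subseteq> interior polygon"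
      using k(1)
      by (intro interior_maximal open_Times) (auto simp: polygon_def intro!: bexI[of _ k])
    moreover have "(x, y) \<in> {0<..<a k} \<times> {0<..<b (Suc k)}" using pos k by simp
    ultimately show False using polygon(2) by blast
  qed
qed

lemma bounded_polygon: "bounded polygon"
  unfolding polygon_def by (intro bounded_UN) (auto intro!: bounded_Times)

lemma cells_subset_region: "cells \<subseteq> region"
proof
  fix p assume p: "p \<in> cells"
  have pos: "0 < fst p" "0 < snd p"
    using p b_nonneg by (force simp: cells_def dest: less_imp_le_nat)+
  have off: "p \<notin> axes \<union> stairs"
    using p pos cells_disjoint_stairs by (auto simp: axes_def)
  let ?C = "connected_component_set (- (axes \<union> stairs)) p"
  have "?C \<subseteq> polygon"
  proof (rule ccontr)
    assume "\<not> ?C \<subseteq> polygon"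
    moreover have "p \<in> ?C" using off by (simp add: connected_component_refl)
    ultimately have "?C \<inter> frontier polygon \<noteq> {}"
      using p cells_subset_polygon
      by (intro connected_Int_frontier connected_connected_component) blast+
    then show False
      using frontier_polygon_subset connected_component_subset[of "- (axes \<union> stairs)" p] by blast
  qed
  then have "bounded ?C" using bounded_polygon bounded_subset by blast
  then show "p \<in> region" using off pos by (auto simp: region_def inside_def)
qed

lemma region_subset_polygon: "region \<subseteq> polygon"
proof (clarify, rule ccontr)
  fix x y assume region: "(x, y) \<in> region" and outside: "(x, y) \<notin> polygon"
  have pos: "0 < x" "0 < y" using region by (auto simp: region_def)
  define ray where "ray = (\<lambda>t. (x + t, y + t)) ` {0..}"
  have "(x + t, y + t) \<notin> polygon" if "0 \<le> t" for t
    using outside pos that by (force simp: polygon_def)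
  then have "ray \<subseteq> - (axes \<union> stairs)"
    using stairs_subset_polygon pos by (auto simp: ray_def axes_def)
  moreover have "connected ray"
    unfolding ray_def by (intro connected_continuous_image continuous_intros) auto
  moreover have "(x, y) \<in> ray" by (auto simp: ray_def intro!: image_eqI[of _ _ 0])
  ultimately have "ray \<subseteq> connected_component_set (- (axes \<union> stairs)) (x, y)"
    by (intro connected_component_maximal)
  moreover have "bounded (connected_component_set (- (axes \<union> stairs)) (x, y))"
    using region by (auto simp: region_def inside_def)
  ultimately have "bounded (fst ` ray)" using bounded_subset bounded_fst by blast
  moreover have "fst ` ray = {x..}"
    by (auto simp: ray_def image_image intro!: image_eqI[of _ _ "_ - x"])
  ultimately obtain C where "\<And>z. x \<le> z \<Longrightarrow> z \<le> C"
    using bounded_imp_bdd_above[of "{x..}"] by (auto simp: bdd_above_def)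
  from this[of "max x (C + 1)"] show False by simp
qed

lemma polygon_subset_strips: "polygon \<subseteq> (\<Union>k<H. {0..a k} \<times> {b k..b (Suc k)})"
proof clarify
  fix x y assume "(x, y) \<in> polygon"
  then obtain m where m: "m < H" "0 \<le> x" "x \<le> a m" "0 \<le> y" "y \<le> b (Suc m)"
    by (auto simp: polygon_def)
  then obtain k where k: "k \<le> m" "\<forall>i<k. \<not> y \<le> b (Suc i)" "y \<le> b (Suc k)"
    using ex_least_nat_le[of "\<lambda>k. y \<le> b (Suc k)" m] by blast
  have "b k \<le> y"
  proof (cases k)
    case 0
    then show ?thesis using b_0 m by simp
  next
    case (Suc i)
    then show ?thesis using k(2) by (simp add: not_le less_imp_le)
  qed
  moreover have "x \<le> a k" using a_antimono[OF k(1)] m by simp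
  ultimately show "(x, y) \<in> (\<Union>k<H. {0..a k} \<times> {b k..b (Suc k)})"
    using m k by (auto intro!: bexI[of _ k])
qed

lemma summand_nonneg: "k < H \<Longrightarrow> 0 \<le> a k * (b (Suc k) - b k)"
  using a_nonneg[of k] b_mono[of k "Suc k"] by simp

lemma emeasure_polygon_le: "emeasure lborel polygon \<le> ennreal (\<Sum>k<H. a k * (b (Suc k) - b k))"
proof -
  have "emeasure lborel polygon \<le> emeasure lborel (\<Union>k<H. {0..a k} \<times> {b k..b (Suc k)})"
    using polygon_subset_strips
    by (intro emeasure_mono) (auto intro!: sets.finite_UN borel_closed closed_Times)
  also have "\<dots> \<le> (\<Sum>k<H. emeasure lborel ({0..a k} \<times> {b k..b (Suc k)}))"
    by (intro emeasure_subadditive_finite) (auto intro!: borel_closed closed_Times)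
  also have "\<dots> = (\<Sum>k<H. ennreal (a k * (b (Suc k) - b k)))"
    using a_nonneg b_mono
    by (intro sum.cong refl) (simp add: emeasure_lborel_Times ennreal_mult)
  also have "\<dots> = ennreal (\<Sum>k<H. a k * (b (Suc k) - b k))"
    using summand_nonneg by (intro sum_ennreal) auto
  finally show ?thesis .
qed

lemma disjoint_cells: "disjoint_family_on (\<lambda>k. {0<..<a k} \<times> {b k<..<b (Suc k)}) {..<H}"
proof -
  have "{0<..<a i} \<times> {b i<..<b (Suc i)} \<inter> {0<..<a k} \<times> {b k<..<b (Suc k)} = {}"
    if "i < k" "k < H" for i k
    using b_mono[of "Suc i" k] that by auto
  then show ?thesis
    unfolding disjoint_family_on_def by (metis Int_commute lessThan_iff linorder_neqE_nat)
qed

lemma emeasure_cells: "emeasure lborel cells = ennreal (\<Sum>k<H. a k * (b (Suc k) - b k))"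
proof -
  have "emeasure lborel cells = (\<Sum>k<H. emeasure lborel ({0<..<a k} \<times> {b k<..<b (Suc k)}))"
    unfolding cells_def
    by (rule sum_emeasure[symmetric]) (auto simp: disjoint_cells intro!: borel_open open_Times)
  also have "\<dots> = (\<Sum>k<H. ennreal (a k * (b (Suc k) - b k)))"
    using a_nonneg b_mono
    by (intro sum.cong refl) (simp add: emeasure_lborel_Times ennreal_mult)
  also have "\<dots> = ennreal (\<Sum>k<H. a k * (b (Suc k) - b k))"
    using summand_nonneg by (intro sum_ennreal) auto
  finally show ?thesis .
qed

lemma open_region: "open region"
proof -
  have "closed axes"
    unfolding axes_def by (intro closed_Collect_disj closed_Collect_eq continuous_intros)
  moreover have "closed stairs" unfolding stairs_def by (intro closed_UN) auto
  ultimately have "open (inside (axes \<union> stairs))" by (intro open_inside) auto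
  moreover have "open {p::real \<times> real. 0 < fst p \<and> 0 < snd p}"
    by (intro open_Collect_conj open_Collect_less continuous_intros)
  ultimately show ?thesis by (auto simp: region_def)
qed

lemma emeasure_region: "emeasure lborel region = ennreal (\<Sum>k<H. a k * (b (Suc k) - b k))"
proof (rule antisym)
  have "polygon \<in> sets lborel"
    unfolding polygon_def by (auto intro!: sets.finite_UN borel_closed closed_Times)
  from emeasure_mono[OF region_subset_polygon this]
  show "emeasure lborel region \<le> ennreal (\<Sum>k<H. a k * (b (Suc k) - b k))"
    using emeasure_polygon_le by (rule order_trans)
  have "region \<in> sets lborel" using open_region by (simp add: borel_open)
  from emeasure_mono[OF cells_subset_region this]
  show "ennreal (\<Sum>k<H. a k * (b (Suc k) - b k)) \<le> emeasure lborel region"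
    by (simp add: emeasure_cells)
qed

end

section \<open>Bounded solutions of the Poisson equation\<close>

definition urn_generator :: "(nat \<Rightarrow> nat \<Rightarrow> real) \<Rightarrow> nat \<Rightarrow> nat \<Rightarrow> real" where
  "urn_generator f a b = real a * (f a (Suc b) - f a b) + real b * (f (a - 1) b - f a b)"

definition bounded_poisson_solution :: "(nat \<Rightarrow> nat \<Rightarrow> real) \<Rightarrow> (nat \<Rightarrow> nat \<Rightarrow> real) \<Rightarrow> bool" where
  "bounded_poisson_solution g f \<longleftrightarrow>
     (\<forall>b. f 0 b = 0) \<and> (\<forall>a\<ge>1. \<forall>b. urn_generator f a b = - g a b) \<and> (\<forall>a. bounded (range (f a)))"

lemma urn_generator_diff:
  "urn_generator (\<lambda>a b. f a b - g a b) a b = urn_generator f a b - urn_generator g a b"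
  by (simp add: urn_generator_def algebra_simps)

lemma urn_generator_cmult: "urn_generator (\<lambda>a b. c * f a b) a b = c * urn_generator f a b"
  by (simp add: urn_generator_def algebra_simps)

lemma urn_maximum_principle:
  assumes zero: "\<And>b. b \<ge> 1 \<Longrightarrow> f 0 b \<le> 0"
    and subharmonic: "\<And>a b. a \<ge> 1 \<Longrightarrow> b \<ge> 1 \<Longrightarrow> 0 \<le> urn_generator f a b"
    and bdd: "\<And>a. bdd_above (f a ` {1..})"
    and "b \<ge> 1"
  shows "f a b \<le> 0"
  using \<open>b \<ge> 1\<close>
proof (induction a arbitrary: b)
  case 0
  then show ?case using zero by simp
next
  case (Suc a)
  define q where "q = real (Suc a) / real (Suc a + 1)"
  define S where "S = (SUP b\<in>{1..}. f (Suc a) b)"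
  have le_S: "f (Suc a) b \<le> S" if "b \<ge> 1" for b
    unfolding S_def using that bdd by (intro cSUP_upper) auto
  have contraction: "f (Suc a) b \<le> q * max 0 S" if b: "b \<ge> 1" for b
  proof -
    have "real (Suc a + b) * f (Suc a) b \<le> real (Suc a) * f (Suc a) (Suc b) + real b * f a b"
      using subharmonic[of "Suc a" b] b by (simp add: urn_generator_def algebra_simps)
    also have "\<dots> \<le> real (Suc a) * max 0 S + 0"
      using le_S[of "Suc b"] Suc.IH[OF b] by (intro add_mono mult_left_mono mult_nonneg_nonpos) auto
    finally have "f (Suc a) b \<le> real (Suc a) / real (Suc a + b) * max 0 S"
      by (simp add: field_simps)
    also have "\<dots> \<le> q * max 0 S"
      unfolding q_def using b by (intro mult_right_mono divide_left_mono) auto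
    finally show ?thesis .
  qed
  have "S \<le> q * max 0 S"
    unfolding S_def using contraction by (intro cSUP_least) (auto simp: S_def)
  moreover have "q * S < S" if "0 < S" using that by (simp add: q_def field_simps)
  ultimately have "S \<le> 0" by (cases "0 < S") auto
  then show ?case using le_S[OF Suc.prems] by simp
qed

lemma urn_comparison:
  assumes zero: "\<And>b. f 0 b = 0"
    and dominated: "\<And>a b. a \<ge> 1 \<Longrightarrow> b \<ge> 1 \<Longrightarrow> \<bar>urn_generator f a b\<bar> \<le> - urn_generator R a b"
    and bounded: "\<And>a. bounded (f a ` {1..})"
    and R_nonneg: "\<And>a b. 0 \<le> R a b"
    and b: "b \<ge> 1"
  shows "\<bar>f a b\<bar> \<le> R a b"
proof -
  have upper: "h a b - R a b \<le> 0"
    if h_0: "\<And>b. h 0 b = 0" and h_bounded: "\<And>a. bounded (h a ` {1..})"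
      and h_gen: "\<And>a b. a \<ge> 1 \<Longrightarrow> b \<ge> 1 \<Longrightarrow> urn_generator R a b \<le> urn_generator h a b" for h
  proof (rule urn_maximum_principle[where f = "\<lambda>a b. h a b - R a b", OF _ _ _ b])
    fix a
    obtain C where "\<And>b. b \<ge> 1 \<Longrightarrow> h a b \<le> C"
      using bounded_imp_bdd_above[OF h_bounded[of a]] by (auto simp: bdd_above_def)
    then have "h a b - R a b \<le> C" if "b \<ge> 1" for b
      using that R_nonneg[of a b] by (smt (verit))
    then show "bdd_above ((\<lambda>b. h a b - R a b) ` {1..})" by (intro bdd_aboveI2) auto
  qed (use h_0 h_gen R_nonneg in \<open>auto simp: urn_generator_diff\<close>)
  have "f a b - R a b \<le> 0"
    using dominated by (intro upper zero bounded) (smt (verit))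
  moreover have "- f a b - R a b \<le> 0"
  proof (rule upper[where h = "\<lambda>a b. - f a b"])
    fix a b :: nat
    assume "a \<ge> 1" "b \<ge> 1"
    then show "urn_generator R a b \<le> urn_generator (\<lambda>a b. - f a b) a b"
      using dominated[of a b] urn_generator_cmult[of "-1" f a b] by simp
  qed (use zero bounded in auto)
  ultimately show ?thesis by linarith
qed

lemma bounded_poisson_solution_unique:
  assumes f: "bounded_poisson_solution g f" and h: "bounded_poisson_solution g h"
  shows "f a b = h a b"
proof -
  define d where "d = (\<lambda>a b. f a b - h a b)"
  have d_0: "d 0 b = 0" for b
    using f h by (simp add: d_def bounded_poisson_solution_def)
  have harmonic: "urn_generator d a b = 0" if "a \<ge> 1" for a b
    using f h that by (simp add: d_def urn_generator_diff bounded_poisson_solution_def)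
  have "bounded (d a ` {1..})" for a
  proof (rule bounded_subset)
    show "bounded (range (d a))"
      using f h unfolding d_def bounded_poisson_solution_def by (intro bounded_minus_comp) auto
  qed auto
  then have "d a b = 0" if "b \<ge> 1" for a b
    using urn_comparison[of d "\<lambda>_ _. 0" b a] that d_0 harmonic by (simp add: urn_generator_def)
  moreover have "d a 0 = d a 1" if "a \<ge> 1"
    using harmonic[OF that, of 0] that by (simp add: urn_generator_def)
  ultimately have "d a b = 0"
    using d_0 by (cases "a = 0"; cases "b = 0") auto
  then show ?thesis by (simp add: d_def)
qed

lemma bounded_poisson_solution_weighted_sum:
  assumes f: "bounded_poisson_solution (\<lambda>_ _. 1) f"
  shows "bounded_poisson_solution (\<lambda>a _. (real a)\<^sup>2) (\<lambda>a b. \<Sum>m=1..a. real m * f m b)"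
proof -
  define h where "h = (\<lambda>a b. \<Sum>m=1..a. real m * f m b)"
  have f_0: "f 0 b = 0" for b
    using f by (simp add: bounded_poisson_solution_def)
  have h_Suc: "h (Suc a) b = h a b + real (Suc a) * f (Suc a) b" for a b
    by (simp add: h_def)
  have h_up: "h a (Suc b) - h a b = real b * f a b - real a" for a b
  proof (induction a)
    case 0
    then show ?case by (simp add: h_def f_0)
  next
    case (Suc a)
    have "urn_generator f (Suc a) b = -1"
      using f by (simp add: bounded_poisson_solution_def)
    then show ?case using Suc by (simp add: h_Suc urn_generator_def algebra_simps)
  qed
  have h_left: "h (a - 1) b - h a b = - (real a * f a b)" for a b
    by (cases a) (simp_all add: h_Suc f_0)
  have "urn_generator h a b = - (real a)\<^sup>2" for a b
    unfolding urn_generator_def h_up h_left by (simp add: power2_eq_square algebra_simps)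
  moreover have "bounded (range (h a))" for a
  proof (induction a)
    case 0
    then show ?case by (simp add: h_def)
  next
    case (Suc a)
    have "bounded (range (f (Suc a)))" using f by (simp add: bounded_poisson_solution_def)
    then have "bounded (range (\<lambda>b. real (Suc a) *\<^sub>R f (Suc a) b))" by (rule bounded_scaleR_comp)
    then show ?case unfolding h_Suc using Suc by (auto intro: bounded_plus_comp)
  qed
  ultimately show ?thesis
    by (simp add: bounded_poisson_solution_def h_def)
qed

section \<open>Comparison with the angle\<close>

definition urn_angle :: "nat \<Rightarrow> nat \<Rightarrow> real" where
  "urn_angle a b = arctan (real a / real b)"

lemma urn_angle_bounds: "0 \<le> urn_angle a b" "urn_angle a b \<le> pi / 2"
  using arctan_ubound[of "real a / real b"] by (auto simp: urn_angle_def)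

lemma square_div_sum_squares_diff_le:
  fixes x y z c :: real
  assumes "x \<noteq> 0" and c: "\<bar>z\<^sup>2 - y\<^sup>2\<bar> \<le> c"
  shows "\<bar>x\<^sup>2 / (x\<^sup>2 + y\<^sup>2) - x\<^sup>2 / (x\<^sup>2 + z\<^sup>2)\<bar> \<le> c / (x\<^sup>2 + y\<^sup>2)"
proof -
  have pos: "0 < x\<^sup>2 + y\<^sup>2" "0 < x\<^sup>2 + z\<^sup>2"
    using assms by (auto simp: sum_power2_gt_zero_iff)
  have "x\<^sup>2 / (x\<^sup>2 + y\<^sup>2) - x\<^sup>2 / (x\<^sup>2 + z\<^sup>2) = x\<^sup>2 / (x\<^sup>2 + z\<^sup>2) * ((z\<^sup>2 - y\<^sup>2) / (x\<^sup>2 + y\<^sup>2))"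
    using pos by (simp add: divide_simps) (simp add: algebra_simps)
  then have "\<bar>x\<^sup>2 / (x\<^sup>2 + y\<^sup>2) - x\<^sup>2 / (x\<^sup>2 + z\<^sup>2)\<bar>
      = x\<^sup>2 / (x\<^sup>2 + z\<^sup>2) * (\<bar>z\<^sup>2 - y\<^sup>2\<bar> / (x\<^sup>2 + y\<^sup>2))"
    using pos by (simp add: abs_mult)
  also have "\<dots> \<le> 1 * (c / (x\<^sup>2 + y\<^sup>2))"
    using pos c by (intro mult_mono divide_right_mono) auto
  finally show ?thesis by simp
qed

lemma urn_angle_up:
  assumes "a \<ge> 1" "b \<ge> 1"
  shows "\<bar>real a * (urn_angle a (Suc b) - urn_angle a b) + (real a)\<^sup>2 / ((real a)\<^sup>2 + (real b)\<^sup>2)\<bar>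
    \<le> (2 * real b + 1) / ((real a)\<^sup>2 + (real b)\<^sup>2)"
proof -
  have "((\<lambda>t. arctan (real a / t)) has_real_derivative - real a / ((real a)\<^sup>2 + t\<^sup>2)) (at t)"
    if "real b \<le> t" for t
    using that assms
    by (auto intro!: derivative_eq_intros simp: divide_simps power2_eq_square)
  from MVT2[of "real b" "real b + 1", OF _ this] obtain \<eta> where \<eta>: "real b < \<eta>" "\<eta> < real b + 1"
    and diff: "urn_angle a (Suc b) - urn_angle a b = - real a / ((real a)\<^sup>2 + \<eta>\<^sup>2)"
    by (auto simp: urn_angle_def add.commute)
  have "(real b)\<^sup>2 \<le> \<eta>\<^sup>2" "\<eta>\<^sup>2 \<le> (real b + 1)\<^sup>2"
    using \<eta> by (auto intro: power_mono)
  then have "\<bar>\<eta>\<^sup>2 - (real b)\<^sup>2\<bar> \<le> 2 * real b + 1"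
    by (simp add: power2_eq_square algebra_simps)
  then show ?thesis
    using square_div_sum_squares_diff_le[of "real a" \<eta> "real b"] assms
    by (simp add: diff power2_eq_square)
qed

lemma urn_angle_left:
  assumes "a \<ge> 1" "b \<ge> 1"
  shows "\<bar>real b * (urn_angle (a - 1) b - urn_angle a b) + (real b)\<^sup>2 / ((real a)\<^sup>2 + (real b)\<^sup>2)\<bar>
    \<le> (2 * real a - 1) / ((real a)\<^sup>2 + (real b)\<^sup>2)"
proof -
  have "((\<lambda>t. arctan (t / real b)) has_real_derivative real b / (t\<^sup>2 + (real b)\<^sup>2)) (at t)" for t
    using assms
    by (auto intro!: derivative_eq_intros simp: divide_simps power2_eq_square)
  from MVT2[of "real a - 1" "real a", OF _ this] obtain \<xi> where \<xi>: "real a - 1 < \<xi>" "\<xi> < real a"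
    and "urn_angle a b - urn_angle (a - 1) b = real b / (\<xi>\<^sup>2 + (real b)\<^sup>2)"
    using assms by (auto simp: urn_angle_def of_nat_diff)
  then have diff: "urn_angle (a - 1) b - urn_angle a b = - real b / ((real b)\<^sup>2 + \<xi>\<^sup>2)"
    by (simp add: add.commute)
  have "(real a - 1)\<^sup>2 \<le> \<xi>\<^sup>2" "\<xi>\<^sup>2 \<le> (real a)\<^sup>2"
    using \<xi> assms by (auto intro: power_mono)
  then have "\<bar>\<xi>\<^sup>2 - (real a)\<^sup>2\<bar> \<le> 2 * real a - 1"
    by (simp add: power2_eq_square algebra_simps)
  then show ?thesis
    using square_div_sum_squares_diff_le[of "real b" \<xi> "real a"] assms
    unfolding diff by (simp add: power2_eq_square add.commute)
qed

lemma urn_generator_angle: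
  assumes "a \<ge> 1" "b \<ge> 1"
  shows "\<bar>urn_generator urn_angle a b + 1\<bar> \<le> 4 / real (a + b)"
proof -
  define x y N where "x = real a" and "y = real b" and "N = x\<^sup>2 + y\<^sup>2"
  have pos: "x \<ge> 1" "y \<ge> 1" "N > 0"
    using assms by (auto simp: x_def y_def N_def sum_power2_gt_zero_iff)
  have "x\<^sup>2 / N + y\<^sup>2 / N = 1"
    using pos by (simp add: N_def add_divide_distrib[symmetric])
  then have "\<bar>urn_generator urn_angle a b + 1\<bar> \<le> (2 * y + 1) / N + (2 * x - 1) / N"
    using urn_angle_up[OF assms] urn_angle_left[OF assms]
    unfolding urn_generator_def x_def[symmetric] y_def[symmetric] N_def[symmetric] by linarith
  also have "\<dots> = 2 * (x + y) / N" by (simp add: add_divide_distrib[symmetric])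
  also have "\<dots> \<le> 4 / (x + y)"
  proof -
    have "0 \<le> (x - y)\<^sup>2" by simp
    then have "(x + y)\<^sup>2 \<le> 2 * N" by (simp add: N_def power2_eq_square algebra_simps)
    then show ?thesis using pos by (simp add: divide_simps power2_eq_square algebra_simps)
  qed
  finally show ?thesis by (simp add: x_def y_def)
qed

text \<open>
  To leading order the generator is the rotation field \<open>x \<partial>/\<partial>y - y \<partial>/\<partial>x\<close>, which maps \<open>x / (x + y)\<^sup>2\<close>
  to \<open>- (2 x\<^sup>2 - x y + y\<^sup>2) / (x + y)\<^sup>3\<close>, and this quadratic form is positive definite.
\<close>
definition urn_barrier :: "nat \<Rightarrow> nat \<Rightarrow> real" where
  "urn_barrier a b = real a / (real (a + b) * (real (a + b) + 1))"

lemma urn_barrier_cubic_nonneg: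
  fixes x y :: real
  assumes "x \<ge> 1" "y \<ge> 1"
  defines "s \<equiv> x + y"
  shows "(s - 1) * (s + 1) * (s + 2) \<le> 8 * x\<^sup>2 * (s - 1) + 4 * y * (y + 1 - x) * (s + 2)"
proof -
  define p q where "p = x - 1" and "q = y - 1"
  have pq: "p \<ge> 0" "q \<ge> 0" using assms by (auto simp: p_def q_def)
  have "8 * x\<^sup>2 * (s - 1) + 4 * y * (y + 1 - x) * (s + 2) - (s - 1) * (s + 1) * (s + 2)
      = q * ((p - 3/2 * q)\<^sup>2 + 3/4 * q\<^sup>2) + (4 * q - 3/2 * p)\<^sup>2 + (2 * p - 7/4)\<^sup>2
        + 7 * p ^ 3 + 23/4 * p\<^sup>2 + 25 * q + 143/16"
    unfolding s_def p_def q_def by (simp add: power2_eq_square power3_eq_cube field_simps)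
  also have "\<dots> \<ge> 0" using pq by (intro add_nonneg_nonneg mult_nonneg_nonneg) auto
  finally show ?thesis by simp
qed

lemma urn_generator_barrier:
  assumes a: "a \<ge> 1" and b: "b \<ge> 1"
  shows "urn_generator urn_barrier a b \<le> - (1 / (4 * real (a + b)))"
proof -
  define x y s where "x = real a" and "y = real b" and "s = x + y"
  have x: "x \<ge> 1" and y: "y \<ge> 1" and s: "s \<ge> 2" using a b by (auto simp: x_def y_def s_def)
  have up: "urn_barrier a (Suc b) - urn_barrier a b = - (2 * x / (s * (s + 1) * (s + 2)))"
    unfolding urn_barrier_def using s
    by (simp add: x_def[symmetric] y_def[symmetric] s_def[symmetric] add.assoc divide_simps) 
       (simp add: algebra_simps)
  have left: "urn_barrier (a - 1) b - urn_barrier a b = (x - y - 1) / ((s - 1) * s * (s + 1))"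
    unfolding urn_barrier_def using s a
    by (simp add: of_nat_diff x_def[symmetric] y_def[symmetric] s_def[symmetric] divide_simps)
       (simp add: s_def algebra_simps)
  have "urn_generator urn_barrier a b
      = - (8 * x\<^sup>2 * (s - 1) + 4 * y * (y + 1 - x) * (s + 2))
        / (4 * s * ((s - 1) * (s + 1) * (s + 2)))"
    unfolding urn_generator_def up left x_def[symmetric] y_def[symmetric] using s
    by (simp add: divide_simps) (simp add: power2_eq_square algebra_simps)
  also have "\<dots> \<le> - ((s - 1) * (s + 1) * (s + 2)) / (4 * s * ((s - 1) * (s + 1) * (s + 2)))"
    using urn_barrier_cubic_nonneg[OF x y] s by (intro divide_right_mono) (auto simp: s_def)
  also have "\<dots> = - (1 / (4 * s))" using s by simp
  finally show ?thesis by (simp add: x_def y_def s_def)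
qed

lemma poisson_solution_near_angle:
  assumes f: "bounded_poisson_solution (\<lambda>_ _. 1) f" and b: "b \<ge> 1"
  shows "\<bar>f a b - urn_angle a b\<bar> \<le> 16 * urn_barrier a b"
proof (rule urn_comparison[OF _ _ _ _ b])
  fix a b :: nat
  assume ab: "a \<ge> 1" "b \<ge> 1"
  have "urn_generator f a b = -1"
    using f ab by (simp add: bounded_poisson_solution_def)
  then have "\<bar>urn_generator (\<lambda>a b. f a b - urn_angle a b) a b\<bar> \<le> 4 / real (a + b)"
    using urn_generator_angle[OF ab] unfolding urn_generator_diff by linarith
  also have "\<dots> = 16 * (1 / (4 * real (a + b)))" by (simp add: divide_simps)
  also have "\<dots> \<le> 16 * (- urn_generator urn_barrier a b)"
    using urn_generator_barrier[OF ab] by (intro mult_left_mono) auto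
  finally show "\<bar>urn_generator (\<lambda>a b. f a b - urn_angle a b) a b\<bar>
      \<le> - urn_generator (\<lambda>a b. 16 * urn_barrier a b) a b"
    by (simp add: urn_generator_cmult)
next
  fix a
  have "bounded (range (f a))" using f by (simp add: bounded_poisson_solution_def)
  then have "bounded (f a ` {1..})" by (rule bounded_subset) auto
  moreover have "bounded (urn_angle a ` {1..})"
    using urn_angle_bounds by (intro bounded_subset[OF bounded_closed_interval[of 0 "pi / 2"]]) auto
  ultimately show "bounded ((\<lambda>b. f a b - urn_angle a b) ` {1..})" by (rule bounded_minus_comp)
qed (use f in \<open>auto simp: bounded_poisson_solution_def urn_angle_def urn_barrier_def\<close>)

lemma poisson_solution_axis_asymptotics:
  assumes f: "bounded_poisson_solution (\<lambda>_ _. 1) f" and m: "m \<ge> 1"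
  shows "\<bar>real m * f m 0 - real m * (pi / 2)\<bar> \<le> 17"
proof -
  have "urn_generator f m 0 = -1"
    using f m by (simp add: bounded_poisson_solution_def)
  then have "real m * f m 0 = 1 + real m * f m 1"
    by (simp add: urn_generator_def algebra_simps)
  moreover have "pi / 2 = urn_angle m 1 + arctan (1 / real m)"
    using arctan_inverse[of "real m"] m by (simp add: urn_angle_def sgn_if inverse_eq_divide)
  ultimately have "real m * f m 0 - real m * (pi / 2)
      = 1 + real m * (f m 1 - urn_angle m 1) - real m * arctan (1 / real m)"
    by (simp only: algebra_simps)
  moreover have "\<bar>real m * (f m 1 - urn_angle m 1)\<bar> \<le> 16"
  proof -
    have "\<bar>real m * (f m 1 - urn_angle m 1)\<bar> \<le> real m * (16 * urn_barrier m 1)"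
      using poisson_solution_near_angle[OF f, of 1 m] by (simp add: abs_mult mult_left_mono)
    also have "\<dots> \<le> 16" by (simp add: urn_barrier_def divide_simps) (simp add: algebra_simps)
    finally show ?thesis .
  qed
  moreover have "real m * arctan (1 / real m) \<le> 1"
    using mult_left_mono[OF arctan_le_self[of "1 / real m"], of "real m"] m by simp
  moreover have "0 \<le> real m * arctan (1 / real m)" by simp
  ultimately show ?thesis by linarith
qed

lemma poisson_solution_weighted_sum_asymptotics:
  assumes f: "bounded_poisson_solution (\<lambda>_ _. 1) f"
  shows "(\<lambda>n. (\<Sum>m=1..n. real m * f m 0) - pi * (real n)\<^sup>2 / 4) \<in> O(real)"
proof (rule bigoI[where c = 18], rule always_eventually, rule allI)
  fix n
  have gauss: "(\<Sum>m=1..n. real m * (pi / 2)) = pi * (real n)\<^sup>2 / 4 + real n * (pi / 4)"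
    by (induction n) (auto simp: power2_eq_square field_simps)
  have "\<bar>(\<Sum>m=1..n. real m * f m 0) - (\<Sum>m=1..n. real m * (pi / 2))\<bar>
      \<le> (\<Sum>m=1..n. \<bar>real m * f m 0 - real m * (pi / 2)\<bar>)"
    by (simp add: sum_subtractf[symmetric] sum_abs)
  also have "\<dots> \<le> (\<Sum>m=1..n. 17)"
    using poisson_solution_axis_asymptotics[OF f] by (intro sum_mono) auto
  finally have "\<bar>(\<Sum>m=1..n. real m * f m 0) - (pi * (real n)\<^sup>2 / 4 + real n * (pi / 4))\<bar>
      \<le> 17 * real n"
    unfolding gauss by simp
  moreover have "0 \<le> real n * (pi / 4)" "real n * (pi / 4) \<le> real n * 1"
    using pi_less_4 by (auto intro: mult_left_mono)
  ultimately have "\<bar>(\<Sum>m=1..n. real m * f m 0) - pi * (real n)\<^sup>2 / 4\<bar> \<le> 18 * real n"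
    by linarith
  then show "norm ((\<Sum>m=1..n. real m * f m 0) - pi * (real n)\<^sup>2 / 4) \<le> 18 * norm (real n)"
    by simp
qed

section \<open>The urn in the first quadrant\<close>

abbreviation urn_states :: "(int \<times> int) set" where
  "urn_states \<equiv> - {(0, 0)}"

abbreviation urn_successors :: "int \<times> int \<Rightarrow> (int \<times> int) set" where
  "urn_successors \<equiv> successors urn_states urn_rate"

definition y_axis :: "(int \<times> int) set" where
  "y_axis = {z. fst z = 0}"

interpretation urn: finitely_branching_rates urn_states urn_rate
proof
  fix z w :: "int \<times> int"
  show "0 \<le> urn_rate z w" by (cases z) (simp add: urn_rate_def)
next
  fix z :: "int \<times> int"
  assume z: "z \<in> urn_states"
  obtain a b where ab: "z = (a, b)" by (cases z)
  have "urn_successors z \<subseteq> {(a - sgn b, b), (a, b + sgn a)}"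
    by (auto simp: successors_def urn_rate_def ab split: if_splits)
  then show "finite (urn_successors z)" by (rule finite_subset) simp
  have "(a, b + sgn a) \<in> urn_successors z" if "a \<noteq> 0"
    using that by (auto simp: successors_def urn_rate_def ab sgn_0_0)
  moreover have "(a - sgn b, b) \<in> urn_successors z" if "a = 0"
    using that z by (auto simp: successors_def urn_rate_def ab sgn_0_0)
  ultimately show "urn_successors z \<noteq> {}" by blast
qed

lemma urn_successors_first_quadrant:
  assumes "0 < a" "0 \<le> b"
  shows "urn_successors (a, b) = (if b = 0 then {(a, b + 1)} else {(a, b + 1), (a - 1, b)})"
  using assms by (auto simp: successors_def urn_rate_def sgn_if split: if_splits)

lemma urn_rate_first_quadrant:
  assumes "0 < a" "0 \<le> b"
  shows "urn_rate (a, b) (a, b + 1) = real_of_int a" "urn_rate (a, b) (a - 1, b) = real_of_int b"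
  using assms by (auto simp: urn_rate_def sgn_if)

lemma exit_rate_urn:
  assumes "a \<ge> 1"
  shows "exit_rate urn_states urn_rate (int a, int b) = real (a + b)"
  using assms urn_rate_first_quadrant[of "int a" "int b"]
  by (cases "b = 0") (simp_all add: urn.exit_rate_eq_sum urn_successors_first_quadrant)

lemma urn_mean_next:
  assumes a: "a \<ge> 1"
  shows "urn.mean_next u (int a, int b)
    = ennreal (real a / real (a + b)) * u (int a, int (Suc b))
      + ennreal (real b / real (a + b)) * u (int (a - 1), int b)"
proof -
  have "jump_prob urn_states urn_rate (int a, int b) (int a, int b + 1) = real a / real (a + b)"
    "jump_prob urn_states urn_rate (int a, int b) (int a - 1, int b) = real b / real (a + b)"
    using a urn_rate_first_quadrant[of "int a" "int b"]
    by (simp_all add: jump_prob_def exit_rate_urn)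
  then show ?thesis
    using a by (cases "b = 0")
      (simp_all add: urn.mean_next_def urn_successors_first_quadrant of_nat_diff add.commute)
qed

text \<open>The second summand pays for the jump off the horizontal axis, which cannot lower \<open>a\<close>.\<close>
definition hitting_barrier :: "nat \<Rightarrow> nat \<Rightarrow> real" where
  "hitting_barrier a b = (real a + 1) ^ 3 + (if b = 0 then real a else 0)"

lemma hitting_barrier_nonneg: "0 \<le> hitting_barrier a b"
  by (simp add: hitting_barrier_def)

lemma hitting_barrier_le: "hitting_barrier a b \<le> (real a + 1) ^ 3 + real a"
  by (simp add: hitting_barrier_def)

lemma hitting_barrier_supersolution:
  assumes a: "a \<ge> 1"
  shows "real a + (real a / real (a + b) * hitting_barrier a (Suc b)
    + real b / real (a + b) * hitting_barrier (a - 1) b) \<le> hitting_barrier a b"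
proof (cases "b = 0")
  case True
  then show ?thesis using a by (simp add: hitting_barrier_def)
next
  case False
  have "real a * real (a + b) \<le> real b * (real a)\<^sup>2 + real b * real a"
    using False mult_right_mono[of 1 "real b" "(real a)\<^sup>2"]
    by (simp add: power2_eq_square algebra_simps)
  also have "\<dots> \<le> real b * (3 * (real a)\<^sup>2 + 3 * real a + 1)"
    unfolding distrib_left[symmetric] by (intro mult_left_mono) auto
  finally have "0 \<le> real b * (3 * (real a)\<^sup>2 + 3 * real a + 1) - real a * real (a + b)"
    by simp
  also have "\<dots> = real (a + b) * (hitting_barrier a b
      - (real a + (real a / real (a + b) * hitting_barrier a (Suc b)
        + real b / real (a + b) * hitting_barrier (a - 1) b)))"
    using a False
    by (simp add: hitting_barrier_def of_nat_diff divide_simps)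
       (simp add: power2_eq_square power3_eq_cube algebra_simps)
  finally show ?thesis using a by (simp add: zero_le_mult_iff)
qed

text \<open>Rewards accrue at rate \<open>g a b\<close>; a jump out of \<open>(a, b)\<close> takes time \<open>1 / (a + b)\<close> on average.\<close>
locale urn_reward =
  fixes r :: "int \<times> int \<Rightarrow> ennreal" and g :: "nat \<Rightarrow> nat \<Rightarrow> real"
  assumes reward: "a \<ge> 1 \<Longrightarrow> r (int a, int b) = ennreal (g a b / real (a + b))"
    and g_nonneg: "0 \<le> g a b"
    and g_le: "a \<ge> 1 \<Longrightarrow> g a b \<le> real a * real (a + b)"
begin

definition expected_total :: "nat \<Rightarrow> nat \<Rightarrow> real" where
  "expected_total a b = enn2real (urn.hitting_value y_axis r (int a, int b))"

lemma expected_total_nonneg: "0 \<le> expected_total a b"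
  by (simp add: expected_total_def)

lemma hitting_value_le_barrier:
  "urn.hitting_value y_axis r (int a, int b) \<le> ennreal (hitting_barrier a b)"
proof -
  define S where
    "S = (\<lambda>(a, b). if 0 \<le> a \<and> 0 \<le> b then ennreal (hitting_barrier (nat a) (nat b)) else \<infinity>)"
  have S_nat: "S (int a, int b) = ennreal (hitting_barrier a b)" for a b by (simp add: S_def)
  have "urn.hitting_value y_axis r (int a, int b) \<le> S (int a, int b)"
  proof (rule urn.hitting_value_le)
    fix z :: "int \<times> int"
    assume z: "z \<notin> y_axis"
    show "r z + urn.mean_next S z \<le> S z"
    proof (cases "0 \<le> fst z \<and> 0 \<le> snd z")
      case True
      then obtain a b where ab: "z = (int a, int b)" and a: "a \<ge> 1"
        using z by (cases z) (auto simp: y_axis_def elim!: nonneg_int_cases)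
      have "r z \<le> ennreal (real a)"
        unfolding ab reward[OF a] using a g_le[OF a, of b]
        by (intro ennreal_leI) (simp add: pos_divide_le_eq)
      then have "r z + urn.mean_next S z \<le> ennreal (real a)
          + (ennreal (real a / real (a + b)) * ennreal (hitting_barrier a (Suc b))
            + ennreal (real b / real (a + b)) * ennreal (hitting_barrier (a - 1) b))"
        unfolding ab urn_mean_next[OF a] S_nat by (intro add_mono order_refl)
      also have "\<dots> = ennreal (real a + (real a / real (a + b) * hitting_barrier a (Suc b)
          + real b / real (a + b) * hitting_barrier (a - 1) b))"
        by (simp add: hitting_barrier_nonneg ennreal_mult' del: times_divide_eq_left)
      also have "\<dots> \<le> ennreal (hitting_barrier a b)"
        by (intro ennreal_leI hitting_barrier_supersolution a)
      finally show ?thesis by (simp only: ab S_nat)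
    qed (auto simp: S_def split_beta)
  qed
  then show ?thesis by (simp only: S_nat)
qed

lemma hitting_value_eq: "urn.hitting_value y_axis r (int a, int b) = ennreal (expected_total a b)"
  unfolding expected_total_def
  by (intro ennreal_enn2real[symmetric] le_less_trans[OF hitting_value_le_barrier]) simp

lemma expected_total_le_barrier: "expected_total a b \<le> hitting_barrier a b"
  using hitting_value_le_barrier[of a b] by (simp add: hitting_value_eq hitting_barrier_nonneg)

lemma expected_total_step:
  assumes a: "a \<ge> 1"
  shows "expected_total a b = g a b / real (a + b)
    + (real a / real (a + b) * expected_total a (Suc b)
      + real b / real (a + b) * expected_total (a - 1) b)"
proof -
  have "ennreal (expected_total a b) = ennreal (g a b / real (a + b))
      + (ennreal (real a / real (a + b)) * ennreal (expected_total a (Suc b))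
        + ennreal (real b / real (a + b)) * ennreal (expected_total (a - 1) b))"
    using urn.hitting_value_unfold[of y_axis r "(int a, int b)"] a
    by (simp only: hitting_value_eq urn_mean_next[OF a] reward[OF a]) (simp add: y_axis_def)
  also have "\<dots> = ennreal (g a b / real (a + b)
      + (real a / real (a + b) * expected_total a (Suc b)
        + real b / real (a + b) * expected_total (a - 1) b))"
    by (simp add: g_nonneg expected_total_nonneg ennreal_mult' del: times_divide_eq_left)
  finally show ?thesis
    using g_nonneg expected_total_nonneg by (subst (asm) ennreal_inj) auto
qed

lemma bounded_poisson_solution_expected_total: "bounded_poisson_solution g expected_total"
proof -
  have "expected_total 0 b = 0" for b
    using urn.hitting_value_unfold[of y_axis r "(0, int b)"]
    by (simp add: expected_total_def y_axis_def)
  moreover have "urn_generator expected_total a b = - g a b" if a: "a \<ge> 1" for a b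
  proof -
    have "real (a + b) * expected_total a b
        = g a b + (real a * expected_total a (Suc b) + real b * expected_total (a - 1) b)"
      using a by (subst expected_total_step) (simp_all add: divide_simps)
    then show ?thesis by (simp add: urn_generator_def algebra_simps)
  qed
  moreover have "bounded (range (expected_total a))" for a
  proof (rule boundedI)
    fix y assume "y \<in> range (expected_total a)"
    then show "norm y \<le> (real a + 1) ^ 3 + real a"
      using expected_total_nonneg order_trans[OF expected_total_le_barrier hitting_barrier_le]
      by auto
  qed
  ultimately show ?thesis by (simp add: bounded_poisson_solution_def)
qed

end

definition strip_area :: "int \<times> int \<Rightarrow> int \<times> int \<Rightarrow> ennreal" where
  "strip_area z w = ennreal (real_of_int (fst z) * (real_of_int (snd w) - real_of_int (snd z)))"

lemma mean_strip_area:
  assumes "a \<ge> 1"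
  shows "urn.mean_next (strip_area (int a, int b)) (int a, int b)
    = ennreal ((real a)\<^sup>2 / real (a + b))"
  unfolding urn_mean_next[OF assms]
  by (simp add: strip_area_def ennreal_mult'[symmetric] power2_eq_square)

interpretation jump_count: urn_reward "\<lambda>_. 1" "\<lambda>a b. real (a + b)"
  by unfold_locales (simp_all add: mult_right_mono)

interpretation holding: urn_reward "\<lambda>z. ennreal (1 / exit_rate urn_states urn_rate z)" "\<lambda>_ _. 1"
proof
  fix a b :: nat
  assume "a \<ge> 1"
  then show "1 \<le> real a * real (a + b)" using mult_mono[of 1 "real a" 1 "real (a + b)"] by simp
qed (simp_all only: exit_rate_urn zero_le_one)

interpretation strip: urn_reward "\<lambda>z. urn.mean_next (strip_area z) z" "\<lambda>a _. (real a)\<^sup>2"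
  by unfold_locales (simp_all add: mean_strip_area power2_eq_square mult_left_mono)

lemma expected_area_eq_sum_expected_time:
  "strip.expected_total n 0 = (\<Sum>m=1..n. real m * holding.expected_total m 0)"
  using bounded_poisson_solution_unique[OF strip.bounded_poisson_solution_expected_total
      bounded_poisson_solution_weighted_sum[OF holding.bounded_poisson_solution_expected_total]] .

section \<open>A single traversal\<close>

locale urn_path = jump_path x for x :: "real \<Rightarrow> int \<times> int" +
  fixes n H :: nat
  assumes start: "jump_chain x 0 = (int n, 0)"
    and jumps: "\<And>k. jump_chain x (Suc k) \<in> urn_successors (jump_chain x k)"
    and hit: "jump_chain x H \<in> y_axis" and before: "\<And>k. k < H \<Longrightarrow> jump_chain x k \<notin> y_axis"
begin

lemma chain_nonneg: "k \<le> H \<Longrightarrow> 0 \<le> fst (jump_chain x k) \<and> 0 \<le> snd (jump_chain x k)"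
proof (induction k)
  case 0
  then show ?case by (simp add: start)
next
  case (Suc k)
  obtain a b where ab: "jump_chain x k = (a, b)" by (cases "jump_chain x k")
  have "0 < a" "0 \<le> b" using Suc before[of k] by (auto simp: ab y_axis_def)
  then show ?case
    using jumps[of k] by (auto simp: ab urn_successors_first_quadrant split: if_splits)
qed

sublocale staircase
  "\<lambda>k. real_of_int (fst (jump_chain x k))" "\<lambda>k. real_of_int (snd (jump_chain x k))" H
proof
  show "real_of_int (snd (jump_chain x 0)) = 0" by (simp add: start)
  show "real_of_int (fst (jump_chain x H)) = 0" using hit by (simp add: y_axis_def)
  fix k assume k: "k < H"
  obtain a b where ab: "jump_chain x k = (a, b)" by (cases "jump_chain x k")
  have "0 < a" "0 \<le> b" using chain_nonneg[of k] before[OF k] k by (auto simp: ab y_axis_def)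
  then show "real_of_int (fst (jump_chain x (Suc k))) = real_of_int (fst (jump_chain x k)) \<and>
      real_of_int (snd (jump_chain x k)) \<le> real_of_int (snd (jump_chain x (Suc k))) \<or>
      real_of_int (fst (jump_chain x (Suc k))) \<le> real_of_int (fst (jump_chain x k)) \<and>
      real_of_int (snd (jump_chain x (Suc k))) = real_of_int (snd (jump_chain x k))"
    using jumps[of k] by (auto simp: ab urn_successors_first_quadrant split: if_splits)
qed

lemma traversal_time_eq_jump_time: "traversal_time x = ennreal (jump_time x H)"
  using hitting_time_eq_jump_time[OF hit before] by (simp add: traversal_time_def y_axis_def)

lemma traversal_time_eq_sum: "traversal_time x = (\<Sum>k<H. ennreal (holding_time x k))"
  using holding_time_pos
  by (simp add: traversal_time_eq_jump_time jump_time_eq_sum sum_ennreal less_imp_le)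

lemma traversal_region_eq: "traversal_region x = region"
proof -
  have "{k. ennreal (jump_time x k) < traversal_time x} = {..<H}"
    using jump_time_nonneg strict_mono_less[OF strict_mono_jump_time]
    by (auto simp: traversal_time_eq_jump_time ennreal_less_iff)
  then have "traversal_path x = stairs"
    by (simp add: traversal_path_def stairs_def lattice_point_def map_prod_def split_beta)
  then show ?thesis by (simp add: traversal_region_def region_def axes_def)
qed

lemma traversal_area_eq_sum:
  "traversal_area x = (\<Sum>k<H. strip_area (jump_chain x k) (jump_chain x (Suc k)))"
  unfolding traversal_area_def traversal_region_eq emeasure_region strip_area_def
  using summand_nonneg by (intro sum_ennreal[symmetric]) auto

end

locale urn_process =
  fixes M :: "'w measure" and A B :: "real \<Rightarrow> 'w \<Rightarrow> int" and n :: nat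
  assumes fast_embedding: "fast_embedding M (int n, 0) A B" and n: "n \<ge> 1"
begin

sublocale jump_process urn_states urn_rate M "(int n, 0)" "\<lambda>t \<omega>. (A t \<omega>, B t \<omega>)"
  using fast_embedding n by unfold_locales (simp_all add: fast_embedding_def)

lemma AE_urn_path: "AE \<omega> in M. \<exists>H. urn_path (\<lambda>t. (A t \<omega>, B t \<omega>)) n H"
proof -
  have "AE \<omega> in M. \<exists>k. state k \<omega> \<in> y_axis"
    using jump_count.hitting_value_eq[of n 0] by (intro AE_hits) simp
  with AE_jumps show ?thesis
  proof eventually_elim
    case (elim \<omega>)
    then obtain H where "state H \<omega> \<in> y_axis" "\<forall>k<H. state k \<omega> \<notin> y_axis"
      using ex_least_nat_le[of "\<lambda>k. state k \<omega> \<in> y_axis"] by blast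
    then have "urn_path (\<lambda>t. (A t \<omega>, B t \<omega>)) n H"
      using elim(1) by unfold_locales (simp_all add: state_def hold_def)
    then show ?case by blast
  qed
qed

lemma expected_traversal_time:
  "(\<integral>\<^sup>+\<omega>. traversal_time (\<lambda>t. (A t \<omega>, B t \<omega>)) \<partial>M) = ennreal (holding.expected_total n 0)"
proof -
  have "(\<integral>\<^sup>+\<omega>. traversal_time (\<lambda>t. (A t \<omega>, B t \<omega>)) \<partial>M)
      = (\<integral>\<^sup>+\<omega>. total_reward y_axis (\<lambda>k \<omega>. ennreal (hold k \<omega>)) \<omega> \<partial>M)"
  proof (rule nn_integral_cong_AE, use AE_urn_path in eventually_elim)
    case (elim \<omega>)
    then obtain H where "urn_path (\<lambda>t. (A t \<omega>, B t \<omega>)) n H" by blast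
    then interpret urn_path "\<lambda>t. (A t \<omega>, B t \<omega>)" n H .
    show ?case
      using hit before by (subst total_reward_eq_sum[where H = H])
        (simp_all add: traversal_time_eq_sum state_def hold_def)
  qed
  then show ?thesis
    using nn_integral_total_hold holding.hitting_value_eq[of n 0] by simp
qed

lemma expected_traversal_area:
  "(\<integral>\<^sup>+\<omega>. traversal_area (\<lambda>t. (A t \<omega>, B t \<omega>)) \<partial>M) = ennreal (strip.expected_total n 0)"
proof -
  have "(\<integral>\<^sup>+\<omega>. traversal_area (\<lambda>t. (A t \<omega>, B t \<omega>)) \<partial>M)
      = (\<integral>\<^sup>+\<omega>. total_reward y_axis (\<lambda>k \<omega>. strip_area (state k \<omega>) (state (Suc k) \<omega>)) \<omega> \<partial>M)"
  proof (rule nn_integral_cong_AE, use AE_urn_path in eventually_elim)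
    case (elim \<omega>)
    then obtain H where "urn_path (\<lambda>t. (A t \<omega>, B t \<omega>)) n H" by blast
    then interpret urn_path "\<lambda>t. (A t \<omega>, B t \<omega>)" n H .
    show ?case
      using hit before by (subst total_reward_eq_sum[where H = H])
        (simp_all add: traversal_area_eq_sum state_def)
  qed
  then show ?thesis
    using nn_integral_total_jump_reward strip.hitting_value_eq[of n 0] by simp
qed

end

lemma of_nat_le_powr:
  assumes "1 \<le> p"
  shows "real n \<le> real n powr p"
  using powr_mono[OF assms, of "real n"] by (cases "n = 0") auto

theorem theorem2p15:
  fixes M :: "nat \<Rightarrow> 'w measure"
    and A B :: "nat \<Rightarrow> real \<Rightarrow> 'w \<Rightarrow> int"
    and E_area E_time :: "nat \<Rightarrow> ennreal"
  assumes fast: "\<And>n. n \<ge> 1 \<Longrightarrow> fast_embedding (M n) (int n, 0) (A n) (B n)"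
  defines "E_area \<equiv> \<lambda>n. \<integral>\<^sup>+\<omega>. traversal_area (\<lambda>t. (A n t \<omega>, B n t \<omega>)) \<partial>M n"
    and "E_time \<equiv> \<lambda>n. \<integral>\<^sup>+\<omega>. traversal_time (\<lambda>t. (A n t \<omega>, B n t \<omega>)) \<partial>M n"
  shows "(\<forall>n\<ge>1. E_area n < \<infinity> \<and> E_area n = (\<Sum>m=1..n. of_nat m * E_time m)) \<and>
         (\<forall>\<delta>::real. \<delta> > 0 \<longrightarrow>
            (\<lambda>n. enn2real (\<Sum>m=1..n. of_nat m * E_time m) - pi * (real n)\<^sup>2 / 4)
              \<in> O(\<lambda>n. real n powr (3/2 + \<delta>)))"
proof -
  have process: "urn_process (M n) (A n) (B n) n" if "n \<ge> 1" for n
    using fast[OF that] that by unfold_locales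
  have area: "E_area n = ennreal (strip.expected_total n 0)" if "n \<ge> 1" for n
    unfolding E_area_def by (rule urn_process.expected_traversal_area[OF process[OF that]])
  have time: "E_time m = ennreal (holding.expected_total m 0)" if "m \<ge> 1" for m
    unfolding E_time_def by (rule urn_process.expected_traversal_time[OF process[OF that]])
  have sum: "(\<Sum>m=1..n. of_nat m * E_time m) = ennreal (strip.expected_total n 0)" for n
    unfolding expected_area_eq_sum_expected_time
    by (subst sum_ennreal[symmetric])
      (auto simp: time holding.expected_total_nonneg ennreal_mult' ennreal_of_nat_eq_real_of_nat)
  have "(\<lambda>n. strip.expected_total n 0 - pi * (real n)\<^sup>2 / 4) \<in> O(\<lambda>n. real n powr (3/2 + \<delta>))"
    if "\<delta> > 0" for \<delta> :: real
  proof (rule landau_o.big_trans)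
    show "(\<lambda>n. strip.expected_total n 0 - pi * (real n)\<^sup>2 / 4) \<in> O(real)"
      unfolding expected_area_eq_sum_expected_time
      by (intro poisson_solution_weighted_sum_asymptotics
          holding.bounded_poisson_solution_expected_total)
    show "real \<in> O(\<lambda>n. real n powr (3/2 + \<delta>))"
      using that by (intro landau_o.big_mono always_eventually) (simp add: of_nat_le_powr)
  qed
  then show ?thesis
    unfolding sum using area strip.expected_total_nonneg by simp
qed

end
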